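(* Let $N\ge 1$, $R,d>0$, $h_0\in(0,1)$, and let $\Omega=(-R,R)\times(a,b)$ with $b>a\ge a_0$, where $a_0=a_0(N,R,d)>1$ is the number fixed in the context. There exists a constant $C_{h_0}=C_{h_0}(N,\Omega,d,h_0)>0$, depending only on the listed parameters, such that the following holds for each $\varepsilon\in[0,1)$ and each $h\in[h_0,1)$ for which $K=2R/h$ is an integer. Let $\mathbf g:\partial\Omega\to\mathbb R^N$ be boundary data with $\mathbf g(x,a)=0$ for all $x$, and assume that $\mathbf g(-R,\cdot),\mathbf g(R,\cdot)\in C^1[a,b]$. Suppose that there exists $\widetilde{\mathbf F}^h(y)=(\mathbf F_0^h(y),\mathbf F_1^h(y),\dots,\mathbf F_K^h(y))^T$ such that $\mathbf F^h=(\mathbf F_1^h,\dots,\mathbf F_{K-1}^h)^T\in H^{1,h}(\Omega^h)$ and $$\mathbf F^h(a)=\mathbf 0,\quad \mathbf F^h(b)=\mathbf g^h(b),\quad \mathbf F_0^h(y)=\mathbf g(-R,y),\quad \mathbf F_K^h(y)=\mathbf g(R,y),\quad y\in[a,b].$$ Then there exists a unique minimizer $\widetilde{\mathbf U}^h_{\min}$, with $\mathbf U^h_{\min}\in H^{1,h}(\Omega^h)$, of the functional $$J^h_\varepsilon(\widetilde{\mathbf U}^h)=\left\|\mathbf U^h_y+D^h\mathbf U^h_x\right\|^2_{L^{2,h}(\Omega^h)}+\varepsilon\left\|\mathbf U^h\right\|^2_{H^{1,h}(\Omega^h)}$$ over the set of all $\widetilde{\mathbf U}^h=(\mathbf U^h_0,\dots,\mathbf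 U^h_K)^T$ with $\mathbf U^h\in H^{1,h}(\Omega^h)$ satisfying $\mathbf U^h(a)=\mathbf 0$, $\mathbf U^h(b)=\mathbf g^h(b)$, $\mathbf U^h_0(y)=\mathbf g(-R,y)$, $\mathbf U^h_K(y)=\mathbf g(R,y)$ for $y\in[a,b]$. Furthermore, $$\left\|\mathbf U^h_{\min}\right\|_{H^{1,h}(\Omega^h)}\le C_{h_0}\left\|\mathbf F^h\right\|_{H^{1,h}(\Omega^h)} .$$
   Context: All functions are real valued. **Basis and matrices.** $\{\Psi_n\}_{n\ge1}$ is the orthonormal basis of $L^2(-d,d)$ obtained by applying Gram–Schmidt orthonormalization to the functions $\alpha^{n-1}e^{\alpha}$, $n=1,2,\dots$. $M_N$ is the $N\times N$ matrix with $(m,n)$ entry $\int_{-d}^d\Psi_n'(\alpha)\Psi_m(\alpha)\,d\alpha$; it is upper triangular with unit diagonal, hence invertible. For $\mathbf x=(x,y)\in\overline\Omega$ let $|\mathbf x-\mathbf x_\alpha|^2=(x-\alpha)^2+y^2$, and let $D_1(\mathbf x),D_2(\mathbf x)$ be the $N\times N$ matrices with entries $$(D_1)_{mn}=-\int_{-d}^d\frac{x-\alpha}{|\mathbf x-\mathbf x_\alpha|^2}\Psi_m(\alpha)\Psi_n(\alpha)\,d\alpha,$$ $$(D_2)_{mn}=\int_{-d}^d\Big(-\frac{x-\alpha}{y}\Psi_m(\alpha)\Psi_n'(\alpha)+\frac{y}{|\mathbf x-\mathbf x_\alpha|^2}\Psi_m(\alpha)\Psi_n(\alpha)\Big)d\alpha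 .$$ The norm of a matrix is the square root of the sum of squares of its entries. The number $a_0=a_0(N,R,d)>1$ is fixed so that for all $b>a\ge a_0$ the matrix $M_N(I-M_N^{-1}D_1(\mathbf x))$ is invertible for all $\mathbf x\in\overline\Omega$ and $D(\mathbf x)=-[M_N(I-M_N^{-1}D_1(\mathbf x))]^{-1}D_2(\mathbf x)$ satisfies $\max_{\overline\Omega}\|D\|\le C_1$ with $C_1$ depending only on $N,R,d$ (such a number exists). **Semi-discretization.** For $h$ with $K=2R/h$ an integer put $x_i=-R+ih$, $i=0,\dots,K$, and $\Omega^h=\{(x_i,y):i=1,\dots,K-1,\ y\in(a,b)\}$. A tuple of $\mathbb R^N$-valued functions of $y\in[a,b]$ indexed by all grid indices is written $\widetilde{\mathbf Q}^h=(\mathbf Q^h_0,\dots,\mathbf Q^h_K)^T$, and its part with interior indices is $\mathbf Q^h=(\mathbf Q^h_1,\dots,\mathbf Q^h_{K-1})^T$; $\mathbf Q^h_i$ represents the values at $x=x_i$. Set $\mathbf Q^h_{jx}(y)=\dfrac{\mathbf Q^h_{j+1}(y)-\mathbf Q^h_{j-1}(y)}{2h}$ for $j=1,\dots,K-1$ (this uses the boundary components $\mathbf Q_0^h,\mathbf Q_K^h$), $\mathbf Q^h_x=(\mathbf Q^h_{1x},\dots,\mathbf Q^h_{(K-1)x})^T$ and $\mathbf Q^h_y=\partial_y\mathbf Q^h$. $D^h(y)$ is the block diagonal matrix with blocks $D(x_1,y),\dots,D(x_{K-1},y)$, so the $j$-th component of $D^h\mathbf Q^h_x$ is $D(x_j,y)\mathbf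 Q^h_{jx}(y)$. For $\mathbf g$ on $\partial\Omega$, $\mathbf g^h(b)=(\mathbf g(x_1,b),\dots,\mathbf g(x_{K-1},b))^T$. **Norms.** $$\|\mathbf U^h\|^2_{L^{2,h}(\Omega^h)}=\sum_{i=1}^{K-1}h\int_a^b|\mathbf U^h_i(y)|^2dy,$$ $$\|\mathbf U^h\|^2_{H^{1,h}(\Omega^h)}=\sum_{j=1}^{K-1}h\int_a^b\big(|\mathbf U^h_{jx}(y)|^2+|\partial_y\mathbf U^h_j(y)|^2+|\mathbf U^h_j(y)|^2\big)dy,$$ where $|\cdot|$ is the Euclidean norm on $\mathbb R^N$; $L^{2,h}(\Omega^h)$ and $H^{1,h}(\Omega^h)$ consist of those $\mathbf U^h$ for which the respective quantity is finite (for $H^{1,h}$ the components are weakly differentiable in $y$). *)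

theory Defs
  imports "HOL-Analysis.Analysis"
begin

text \<open>
  Throughout, \<open>N\<close> is the cardinality of a finite linearly ordered index type \<open>'n\<close>, so that vectors
  and matrices are \<open>real^'n\<close> and \<open>real^'n^'n\<close>. The library norm on \<open>real^'n^'n\<close> is the square root
  of the sum of the squares of the entries.
\<close>


section \<open>The basis and the matrices\<close>

text \<open>The basis functions are numbered from 1; the value at index 0 is junk and is never used.\<close>

definition l2_inner :: "real \<Rightarrow> (real \<Rightarrow> real) \<Rightarrow> (real \<Rightarrow> real) \<Rightarrow> real" where
  "l2_inner d f g = integral {-d..d} (\<lambda>\<alpha>. f \<alpha> * g \<alpha>)"

definition phi :: "nat \<Rightarrow> real \<Rightarrow> real" where
  "phi n \<alpha> = \<alpha> ^ (n - 1) * exp \<alpha>"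

function Psi :: "real \<Rightarrow> nat \<Rightarrow> real \<Rightarrow> real" where
  "Psi d n =
     (let u = (\<lambda>\<alpha>. phi n \<alpha> - (\<Sum>k\<in>{1..<n}. l2_inner d (phi n) (Psi d k) * Psi d k \<alpha>))
      in (\<lambda>\<alpha>. u \<alpha> / sqrt (l2_inner d u u)))"
  by pat_completeness auto
termination by (relation "Wellfounded.measure snd") auto

declare Psi.simps [simp del]

text \<open>Position of an index in \<open>{1..N}\<close> (the order matters, since Gram--Schmidt is sequential).\<close>

definition idx :: "'n::{finite,linorder} \<Rightarrow> nat" where
  "idx i = card {j. j \<le> i}"

definition M_mat :: "real \<Rightarrow> real^'n::{finite,linorder}^'n::{finite,linorder}" where
  "M_mat d = (\<chi> m n. integral {-d..d} (\<lambda>\<alpha>. deriv (Psi d (idx n)) \<alpha> * Psi d (idx m) \<alpha>))"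

definition D1_mat :: "real \<Rightarrow> real \<Rightarrow> real \<Rightarrow> real^'n::{finite,linorder}^'n::{finite,linorder}" where
  "D1_mat d x y = (\<chi> m n. - integral {-d..d} (\<lambda>\<alpha>.
     (x - \<alpha>) / ((x - \<alpha>)\<^sup>2 + y\<^sup>2) * Psi d (idx m) \<alpha> * Psi d (idx n) \<alpha>))"

definition D2_mat :: "real \<Rightarrow> real \<Rightarrow> real \<Rightarrow> real^'n::{finite,linorder}^'n::{finite,linorder}" where
  "D2_mat d x y = (\<chi> m n. integral {-d..d} (\<lambda>\<alpha>.
     - ((x - \<alpha>) / y) * Psi d (idx m) \<alpha> * deriv (Psi d (idx n)) \<alpha>
     + y / ((x - \<alpha>)\<^sup>2 + y\<^sup>2) * Psi d (idx m) \<alpha> * Psi d (idx n) \<alpha>))"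

definition lead_mat :: "real \<Rightarrow> real \<Rightarrow> real \<Rightarrow> real^'n::{finite,linorder}^'n::{finite,linorder}" where
  "lead_mat d x y = M_mat d ** (mat 1 - matrix_inv (M_mat d) ** D1_mat d x y)"

definition D_mat :: "real \<Rightarrow> real \<Rightarrow> real \<Rightarrow> real^'n::{finite,linorder}^'n::{finite,linorder}" where
  "D_mat d x y = - (matrix_inv (lead_mat d x y) ** D2_mat d x y)"

text \<open>
  The requirement on the number \<open>a\<^sub>0 = a\<^sub>0(N,R,d)\<close>. The bound \<open>C\<^sub>1\<close> is quantified before \<open>a\<close>, \<open>b\<close>,
  hence depends only on \<open>N\<close>, \<open>R\<close>, \<open>d\<close> and \<open>a\<^sub>0\<close>. The type argument carries \<open>N\<close>.
\<close>

definition admissible_a0 :: "'n::{finite,linorder} itself \<Rightarrow> real \<Rightarrow> real \<Rightarrow> real \<Rightarrow> bool" where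
  "admissible_a0 _ R d a0 \<longleftrightarrow> a0 > 1 \<and>
     (\<exists>C1. \<forall>a b. a0 \<le> a \<and> a < b \<longrightarrow>
        (\<forall>x\<in>{-R..R}. \<forall>y\<in>{a..b}.
           invertible (lead_mat d x y :: real^'n::{finite,linorder}^'n::{finite,linorder}) \<and>
           norm (D_mat d x y :: real^'n::{finite,linorder}^'n::{finite,linorder}) \<le> C1))"


section \<open>Weak derivatives on an interval\<close>

text \<open>
  Test functions are the compactly supported \<open>C\<^sup>1\<close> functions, as is usual in one dimension
  (e.g. Brezis, Functional Analysis, Sobolev Spaces and PDE, Chapter 8).
\<close>

definition test_function :: "real \<Rightarrow> real \<Rightarrow> (real \<Rightarrow> real) \<Rightarrow> bool" where
  "test_function a b \<phi> \<longleftrightarrow>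
     \<phi> C1_differentiable_on UNIV \<and> closure {y. \<phi> y \<noteq> 0} \<subseteq> {a<..<b}"

definition locally_integrable :: "real \<Rightarrow> real \<Rightarrow> (real \<Rightarrow> 'v::euclidean_space) \<Rightarrow> bool" where
  "locally_integrable a b u \<longleftrightarrow>
     (\<forall>s t. a < s \<and> t < b \<longrightarrow> set_integrable lborel {s..t} u)"

definition has_weak_derivative ::
    "real \<Rightarrow> real \<Rightarrow> (real \<Rightarrow> 'v::euclidean_space) \<Rightarrow> (real \<Rightarrow> 'v) \<Rightarrow> bool" where
  "has_weak_derivative a b u v \<longleftrightarrow>
     locally_integrable a b u \<and> locally_integrable a b v \<and>
     (\<forall>\<phi>. test_function a b \<phi> \<longrightarrow>
        (LINT y:{a<..<b}|lborel. deriv \<phi> y *\<^sub>R u y) = - (LINT y:{a<..<b}|lborel. \<phi> y *\<^sub>R v y))"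

definition weakly_differentiable :: "real \<Rightarrow> real \<Rightarrow> (real \<Rightarrow> 'v::euclidean_space) \<Rightarrow> bool" where
  "weakly_differentiable a b u \<longleftrightarrow> (\<exists>v. has_weak_derivative a b u v)"

text \<open>The weak derivative is unique up to null sets; an arbitrary version is chosen.\<close>

definition wderiv :: "real \<Rightarrow> real \<Rightarrow> (real \<Rightarrow> 'v::euclidean_space) \<Rightarrow> real \<Rightarrow> 'v" where
  "wderiv a b u = (SOME v. has_weak_derivative a b u v)"

definition square_integrable :: "real \<Rightarrow> real \<Rightarrow> (real \<Rightarrow> 'v::euclidean_space) \<Rightarrow> bool" where
  "square_integrable a b u \<longleftrightarrow>
     set_borel_measurable lborel {a<..<b} u \<and>
     set_integrable lborel {a<..<b} (\<lambda>y. (norm (u y))\<^sup>2)"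


section \<open>The semi-discrete spaces and the functional\<close>

text \<open>
  A tuple \<open>(U\<^sub>0, \<dots>, U\<^sub>K)\<close> of functions on \<open>[a,b]\<close> is a function \<open>U :: nat \<Rightarrow> real \<Rightarrow> real^'n\<close> of which
  only the values \<open>U i y\<close> with \<open>i \<le> K\<close> and \<open>y \<in> {a..b}\<close> matter. The interior indices are \<open>{1..<K}\<close>.
  The norms and the functional take the whole tuple, because the difference quotients at the
  first and last interior index involve \<open>U\<^sub>0\<close> and \<open>U\<^sub>K\<close>.
\<close>

definition grid_pt :: "real \<Rightarrow> real \<Rightarrow> nat \<Rightarrow> real" where
  "grid_pt R h i = - R + real i * h"

definition diff_x :: "real \<Rightarrow> (nat \<Rightarrow> real \<Rightarrow> 'v::euclidean_space) \<Rightarrow> nat \<Rightarrow> real \<Rightarrow> 'v" where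
  "diff_x h U j y = (U (j + 1) y - U (j - 1) y) /\<^sub>R (2 * h)"

definition L2h_norm_sq ::
    "real \<Rightarrow> real \<Rightarrow> nat \<Rightarrow> real \<Rightarrow> (nat \<Rightarrow> real \<Rightarrow> 'v::euclidean_space) \<Rightarrow> real" where
  "L2h_norm_sq a b K h U = (\<Sum>i\<in>{1..<K}. h * (LINT y:{a<..<b}|lborel. (norm (U i y))\<^sup>2))"

definition H1h_norm_sq ::
    "real \<Rightarrow> real \<Rightarrow> nat \<Rightarrow> real \<Rightarrow> (nat \<Rightarrow> real \<Rightarrow> 'v::euclidean_space) \<Rightarrow> real" where
  "H1h_norm_sq a b K h U = (\<Sum>j\<in>{1..<K}. h * (LINT y:{a<..<b}|lborel.
     (norm (diff_x h U j y))\<^sup>2 + (norm (wderiv a b (U j) y))\<^sup>2 + (norm (U j y))\<^sup>2))"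

definition H1h_norm ::
    "real \<Rightarrow> real \<Rightarrow> nat \<Rightarrow> real \<Rightarrow> (nat \<Rightarrow> real \<Rightarrow> 'v::euclidean_space) \<Rightarrow> real" where
  "H1h_norm a b K h U = sqrt (H1h_norm_sq a b K h U)"

text \<open>
  Membership of the interior part in \<open>H\<^sup>1\<^sup>,\<^sup>h\<close>. Each interior component is required to be the
  continuous representative of its class on \<open>[a,b]\<close>, so that its values at \<open>a\<close> and \<open>b\<close> are the traces.
\<close>

definition H1h ::
    "real \<Rightarrow> real \<Rightarrow> nat \<Rightarrow> real \<Rightarrow> (nat \<Rightarrow> real \<Rightarrow> 'v::euclidean_space) \<Rightarrow> bool" where
  "H1h a b K h U \<longleftrightarrow> (\<forall>j\<in>{1..<K}.
     continuous_on {a..b} (U j) \<and> weakly_differentiable a b (U j) \<and>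
     square_integrable a b (diff_x h U j) \<and>
     square_integrable a b (wderiv a b (U j)) \<and>
     square_integrable a b (U j))"

definition feasible ::
    "real \<Rightarrow> real \<Rightarrow> real \<Rightarrow> nat \<Rightarrow> real \<Rightarrow> (real \<times> real \<Rightarrow> 'v::euclidean_space)
       \<Rightarrow> (nat \<Rightarrow> real \<Rightarrow> 'v) \<Rightarrow> bool" where
  "feasible R a b K h g U \<longleftrightarrow>
     H1h a b K h U \<and>
     (\<forall>i\<in>{1..<K}. U i a = 0 \<and> U i b = g (grid_pt R h i, b)) \<and>
     (\<forall>y\<in>{a..b}. U 0 y = g (-R, y) \<and> U K y = g (R, y))"

definition J_fun ::
    "real \<Rightarrow> real \<Rightarrow> real \<Rightarrow> real \<Rightarrow> nat \<Rightarrow> real \<Rightarrow> real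
       \<Rightarrow> (nat \<Rightarrow> real \<Rightarrow> real^'n::{finite,linorder}) \<Rightarrow> real" where
  "J_fun R d a b K h \<epsilon> U =
     L2h_norm_sq a b K h
       (\<lambda>j y. wderiv a b (U j) y + D_mat d (grid_pt R h j) y *v diff_x h U j y)
     + \<epsilon> * H1h_norm_sq a b K h U"

text \<open>\<open>C\<^sup>1[a,b]\<close>, with one-sided derivatives at the end points.\<close>

definition C1_closed :: "real \<Rightarrow> real \<Rightarrow> (real \<Rightarrow> 'v::real_normed_vector) \<Rightarrow> bool" where
  "C1_closed a b f \<longleftrightarrow>
     (\<exists>f'. continuous_on {a..b} f' \<and>
        (\<forall>y\<in>{a..b}. (f has_vector_derivative f' y) (at y within {a..b})))"

end

theory Submission
  imports Defs
begin

text \<open>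
  The interior components of a feasible tuple vanish at \<open>a\<close>, so they are the primitives of their weak
  derivatives. For the difference of two feasible tuples the boundary terms of the difference
  quotients vanish too, and the first-order expression of the functional becomes \<open>W' + A W\<close> with a
  matrix bounded by \<open>C\<^sub>1 / h\<^sub>0\<close>. With the weight \<open>exp (- \<kappa> y)\<close>, \<open>\<kappa>\<close> large, integration from \<open>a\<close>
  has small norm, hence the \<open>L\<^sup>2\<close> norm of \<open>W'\<close> is controlled by that of \<open>W' + A W\<close> even when
  \<open>\<epsilon> = 0\<close>. Thus the functional is uniformly convex in \<open>W'\<close>: by the parallelogram law a minimizing
  sequence is Cauchy and the minimizer is unique, and comparing its value with that of
  \<open>F\<close> gives the estimate.
\<close>

section \<open>Square-integrable functions\<close>

text \<open>For h >= \<open>h0\<close> a central difference is a bounded operator on the values, so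
  D^h U_x is a zero-order perturbation of d/dy and the key estimate is a Gronwall inequality in
  weighted L2 form. The price is an exponential constant whose exponent contains C1^2 / h0^2. The
  main obstacle is \<open>wderiv\<close>: it selects an arbitrary version, so it is additive only
  almost everywhere and its measurability is not automatic. Hence the argument compares the chosen
  derivatives of two feasible tuples pointwise, instead of differentiating their difference, and
  appeals to almost everywhere uniqueness only where a new function (a midpoint or a limit) has to
  be differentiated. All quantities (values, difference quotients, residuals, the functional) are
  controlled by one number, the squared L2 distance of the weak derivatives. Existence can then be
  left to an abstract statement about a functional that is uniformly convex with respect to this
  number.\<close>

definition L2 :: "'a measure \<Rightarrow> ('a \<Rightarrow> 'v::euclidean_space) \<Rightarrow> bool" where
  "L2 M f \<longleftrightarrow> f \<in> borel_measurable M \<and> integrable M (\<lambda>x. (norm (f x))\<^sup>2)"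

text \<open>The integral of a non-integrable function is 0 by convention, so inequalities between
  values of \<open>nsq\<close> carry \<open>L2\<close> hypotheses.\<close>

definition nsq :: "'a measure \<Rightarrow> ('a \<Rightarrow> 'v::euclidean_space) \<Rightarrow> real" where
  "nsq M f = (LINT x|M. (norm (f x))\<^sup>2)"

lemma norm_add_sq_le:
  fixes x y :: "'v::real_inner"
  shows "(norm (x + y))\<^sup>2 \<le> 2 * (norm x)\<^sup>2 + 2 * (norm y)\<^sup>2"
proof -
  have "0 \<le> (norm (x - y))\<^sup>2" by simp
  then show ?thesis unfolding power2_norm_eq_inner by (simp add: inner_simps inner_commute)
qed

lemma norm_diff_sq_le:
  fixes x y :: "'v::real_inner"
  shows "(norm (x - y))\<^sup>2 \<le> 2 * (norm x)\<^sup>2 + 2 * (norm y)\<^sup>2"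
  using norm_add_sq_le[of x "- y"] by simp

text \<open>Young's inequality with a free parameter. The leading factor can be brought arbitrarily
  close to 1, as the limit along a minimizing sequence requires; the factor 2 of
  \<open>norm_add_sq_le\<close> would lose the exact infimum.\<close>

lemma norm_sq_le_weighted:
  fixes x y :: "'v::real_inner"
  assumes "\<eta> > 0"
  shows "(norm x)\<^sup>2 \<le> (1 + \<eta>) * (norm y)\<^sup>2 + (1 + 1/\<eta>) * (norm (x - y))\<^sup>2"
proof -
  define z where "z = x - y"
  have x: "x = y + z" by (simp add: z_def)
  have "0 \<le> (norm (\<eta> *\<^sub>R y - z))\<^sup>2 / \<eta>" using assms by simp
  also have "\<dots> = \<eta> * (norm y)\<^sup>2 + (norm z)\<^sup>2 / \<eta> - 2 * (y \<bullet> z)"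
    using assms unfolding power2_norm_eq_inner
    by (simp add: inner_simps inner_commute divide_simps)
  finally have "2 * (y \<bullet> z) \<le> \<eta> * (norm y)\<^sup>2 + (norm z)\<^sup>2 / \<eta>" by simp
  moreover have "(norm x)\<^sup>2 = (norm y)\<^sup>2 + (norm z)\<^sup>2 + 2 * (y \<bullet> z)"
    unfolding x power2_norm_eq_inner by (simp add: inner_simps inner_commute)
  ultimately show ?thesis by (simp add: z_def algebra_simps)
qed

lemma parallelogram_mid:
  fixes x y :: "'v::real_inner"
  shows "(norm x)\<^sup>2 + (norm y)\<^sup>2 - 2 * (norm ((1/2) *\<^sub>R (x + y)))\<^sup>2 = (norm (x - y))\<^sup>2 / 2"
  unfolding power2_norm_eq_inner by (simp add: inner_simps inner_commute field_simps)

lemma L2D [dest]: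
  assumes "L2 M f"
  shows "f \<in> borel_measurable M" "integrable M (\<lambda>x. (norm (f x))\<^sup>2)"
  using assms by (auto simp: L2_def)

lemma L2_bound:
  assumes "integrable M g" "f \<in> borel_measurable M" "\<And>x. x \<in> space M \<Longrightarrow> (norm (f x))\<^sup>2 \<le> g x"
  shows "L2 M f"
  unfolding L2_def
proof
  show "integrable M (\<lambda>x. (norm (f x))\<^sup>2)"
  proof (rule Bochner_Integration.integrable_bound[OF assms(1)])
    show "AE x in M. norm ((norm (f x))\<^sup>2) \<le> norm (g x)"
      using assms(3) by (intro AE_I2) fastforce
  qed (use assms(2) in measurable)
qed (rule assms)

lemma L2_add:
  assumes "L2 M f" "L2 M g"
  shows "L2 M (\<lambda>x. f x + g x)"
proof (rule L2_bound)
  show "integrable M (\<lambda>x. 2 * (norm (f x))\<^sup>2 + 2 * (norm (g x))\<^sup>2)"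
    using assms by (auto simp: L2_def)
  show "(\<lambda>x. f x + g x) \<in> borel_measurable M"
    using assms by (auto simp: L2_def)
qed (rule norm_add_sq_le)

lemma L2_scaleR: "L2 M f \<Longrightarrow> L2 M (\<lambda>x. c *\<^sub>R f x)"
  by (auto simp: L2_def power_mult_distrib)

lemma L2_diff:
  assumes "L2 M f" "L2 M g"
  shows "L2 M (\<lambda>x. f x - g x)"
  using L2_add[OF assms(1) L2_scaleR[OF assms(2), of "-1"]] by simp

lemma L2_cong_AE:
  assumes "L2 M f" "AE x in M. f x = g x" "g \<in> borel_measurable M"
  shows "L2 M g"
proof -
  have "integrable M (\<lambda>x. (norm (g x))\<^sup>2)"
  proof (rule integrable_cong_AE_imp[OF L2D(2)[OF assms(1)]])
    show "AE x in M. (norm (f x))\<^sup>2 = (norm (g x))\<^sup>2" using assms(2) by eventually_elim simp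
  qed (use assms(3) in measurable)
  then show ?thesis using assms(3) by (simp add: L2_def)
qed

lemma nsq_nonneg [simp]: "0 \<le> nsq M f"
  by (simp add: nsq_def)

lemma nsq_cong_AE:
  assumes "AE x in M. f x = g x" "f \<in> borel_measurable M" "g \<in> borel_measurable M"
  shows "nsq M f = nsq M g"
  unfolding nsq_def
proof (rule integral_cong_AE)
  show "AE x in M. (norm (f x))\<^sup>2 = (norm (g x))\<^sup>2" using assms(1) by eventually_elim simp
qed (use assms in measurable)

lemma nsq_minus_commute: "nsq M (\<lambda>x. f x - g x) = nsq M (\<lambda>x. g x - f x)"
  by (simp add: nsq_def norm_minus_commute)

lemma nsq_add_le:
  assumes "L2 M f" "L2 M g"
  shows "nsq M (\<lambda>x. f x + g x) \<le> 2 * nsq M f + 2 * nsq M g"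
proof -
  have i: "integrable M (\<lambda>x. (norm (f x))\<^sup>2)" "integrable M (\<lambda>x. (norm (g x))\<^sup>2)"
    using assms by (auto simp: L2_def)
  have "nsq M (\<lambda>x. f x + g x) \<le> (LINT x|M. 2 * (norm (f x))\<^sup>2 + 2 * (norm (g x))\<^sup>2)"
    unfolding nsq_def using i L2D[OF L2_add[OF assms]]
    by (intro integral_mono) (auto intro: norm_add_sq_le)
  also have "\<dots> = 2 * nsq M f + 2 * nsq M g"
    unfolding nsq_def using i by (subst Bochner_Integration.integral_add) auto
  finally show ?thesis .
qed

lemma nsq_diff_le:
  assumes "L2 M f" "L2 M g"
  shows "nsq M (\<lambda>x. f x - g x) \<le> 2 * nsq M f + 2 * nsq M g"
  using nsq_add_le[OF assms(1) L2_scaleR[OF assms(2), of "-1"]] by (simp add: nsq_def)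

lemma nsq_le_weighted:
  assumes "L2 M f" "L2 M g" "\<eta> > 0"
  shows "nsq M f \<le> (1 + \<eta>) * nsq M g + (1 + 1/\<eta>) * nsq M (\<lambda>x. f x - g x)"
proof -
  note d = L2D[OF L2_diff[OF assms(1,2)]] L2D[OF assms(1)] L2D[OF assms(2)]
  have "nsq M f \<le> (LINT x|M. (1 + \<eta>) * (norm (g x))\<^sup>2 + (1 + 1/\<eta>) * (norm (f x - g x))\<^sup>2)"
    unfolding nsq_def using d
    by (intro integral_mono norm_sq_le_weighted[OF assms(3)]) auto
  also have "\<dots> = (1 + \<eta>) * nsq M g + (1 + 1/\<eta>) * nsq M (\<lambda>x. f x - g x)"
    unfolding nsq_def using d by (subst Bochner_Integration.integral_add) auto
  finally show ?thesis .
qed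

lemma nsq_mid:
  assumes "L2 M f" "L2 M g"
  shows "nsq M f + nsq M g - 2 * nsq M (\<lambda>x. (1/2) *\<^sub>R (f x + g x)) = nsq M (\<lambda>x. f x - g x) / 2"
proof -
  note d = L2D[OF L2_diff[OF assms]] L2D[OF assms(1)] L2D[OF assms(2)]
    L2D[OF L2_scaleR[OF L2_add[OF assms], of "1/2"]]
  have "nsq M f + nsq M g - 2 * nsq M (\<lambda>x. (1/2) *\<^sub>R (f x + g x)) =
    (LINT x|M. (norm (f x))\<^sup>2 + (norm (g x))\<^sup>2 - 2 * (norm ((1/2) *\<^sub>R (f x + g x)))\<^sup>2)"
    unfolding nsq_def using d by simp
  then show ?thesis unfolding parallelogram_mid nsq_def by simp
qed

section \<open>Cauchy-Schwarz and completeness of L2\<close>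

lemma Cauchy_Schwarz_integral:
  fixes f g :: "'a \<Rightarrow> real"
  assumes "f \<in> borel_measurable M" "g \<in> borel_measurable M"
    and "integrable M (\<lambda>x. (f x)\<^sup>2)" "integrable M (\<lambda>x. (g x)\<^sup>2)"
  shows "integrable M (\<lambda>x. f x * g x)"
    and "(LINT x|M. f x * g x)\<^sup>2 \<le> (LINT x|M. (f x)\<^sup>2) * (LINT x|M. (g x)\<^sup>2)"
proof -
  have le: "\<bar>f x * g x\<bar> \<le> (f x)\<^sup>2 + (g x)\<^sup>2" for x
  proof -
    have "0 \<le> (\<bar>f x\<bar> - \<bar>g x\<bar>)\<^sup>2" by simp
    then have "2 * (\<bar>f x\<bar> * \<bar>g x\<bar>) \<le> (f x)\<^sup>2 + (g x)\<^sup>2" by (simp add: power2_eq_square algebra_simps)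
    moreover have "0 \<le> \<bar>f x\<bar> * \<bar>g x\<bar>" by simp
    ultimately show ?thesis unfolding abs_mult by linarith
  qed
  show int: "integrable M (\<lambda>x. f x * g x)"
  proof (rule Bochner_Integration.integrable_bound[OF Bochner_Integration.integrable_add[OF assms(3,4)]])
    show "AE x in M. norm (f x * g x) \<le> norm ((f x)\<^sup>2 + (g x)\<^sup>2)" using le by (intro AE_I2) fastforce
  qed (use assms in measurable)
  define A B C where "A = (LINT x|M. (f x)\<^sup>2)" "B = (LINT x|M. f x * g x)" "C = (LINT x|M. (g x)\<^sup>2)"
  \<comment> \<open>A nonnegative quadratic form in t and s; its determinant gives the
    claim.\<close>
  have q: "0 \<le> t\<^sup>2 * A - 2 * t * s * B + s\<^sup>2 * C" for t s
  proof -
    have "0 \<le> (LINT x|M. (t * f x - s * g x)\<^sup>2)" by simp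
    also have "\<dots> = (LINT x|M. t\<^sup>2 * (f x)\<^sup>2 - 2 * t * s * (f x * g x) + s\<^sup>2 * (g x)\<^sup>2)"
      by (intro Bochner_Integration.integral_cong refl) (simp add: power2_eq_square algebra_simps)
    also have "\<dots> = t\<^sup>2 * A - 2 * t * s * B + s\<^sup>2 * C"
      unfolding A_B_C_def using assms int by (simp add: mult.assoc)
    finally show ?thesis .
  qed
  have "0 \<le> A" "0 \<le> C" by (simp_all add: A_B_C_def)
  have "B\<^sup>2 \<le> A * C"
  proof (cases "C = 0")
    case True
    have "B = 0"
    proof (rule ccontr)
      assume "B \<noteq> 0"
      \<comment> \<open>For C = 0 and t = 1 the form is affine in s, and this value of s drives it
        to -1.\<close>
      have "0 \<le> A - 2 * ((A + 1) / (2 * B)) * B" using q[of 1 "(A + 1) / (2 * B)"] True by simp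
      also have "\<dots> = - 1" using \<open>B \<noteq> 0\<close> by (simp add: field_simps)
      finally show False by simp
    qed
    then show ?thesis using True by simp
  next
    case False
    \<comment> \<open>At t = C, s = B the form factors as C (A C - B^2).\<close>
    have "0 \<le> C * (A * C - B\<^sup>2)" using q[of C B] by (simp add: power2_eq_square algebra_simps)
    then show ?thesis using False \<open>0 \<le> C\<close> by (simp add: zero_le_mult_iff)
  qed
  then show "(LINT x|M. f x * g x)\<^sup>2 \<le> (LINT x|M. (f x)\<^sup>2) * (LINT x|M. (g x)\<^sup>2)"
    by (simp add: A_B_C_def)
qed

lemma L2_integral_weighted:
  fixes v :: "'a \<Rightarrow> 'v::euclidean_space" and \<psi> :: "'a \<Rightarrow> real"
  assumes v: "L2 M v" and \<psi>: "\<psi> \<in> borel_measurable M" "integrable M (\<lambda>x. (\<psi> x)\<^sup>2)"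
  shows "integrable M (\<lambda>x. \<psi> x *\<^sub>R v x)"
    and "(norm (LINT x|M. \<psi> x *\<^sub>R v x))\<^sup>2 \<le> (LINT x|M. (\<psi> x)\<^sup>2) * nsq M v"
proof -
  have mv: "(\<lambda>x. norm (v x)) \<in> borel_measurable M" and m\<psi>: "(\<lambda>x. \<bar>\<psi> x\<bar>) \<in> borel_measurable M"
    using v \<psi> by (auto simp: L2_def)
  note CS = Cauchy_Schwarz_integral[OF m\<psi> mv]
  have i: "integrable M (\<lambda>x. \<bar>\<psi> x\<bar> * norm (v x))" using CS \<psi> v by (auto simp: L2_def)
  show "integrable M (\<lambda>x. \<psi> x *\<^sub>R v x)"
    by (rule Bochner_Integration.integrable_bound[OF i]) (use v \<psi> in \<open>auto simp: L2_def\<close>)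
  have "norm (LINT x|M. \<psi> x *\<^sub>R v x) \<le> (LINT x|M. norm (\<psi> x *\<^sub>R v x))"
    by (rule integral_norm_bound)
  then have "(norm (LINT x|M. \<psi> x *\<^sub>R v x))\<^sup>2 \<le> (LINT x|M. \<bar>\<psi> x\<bar> * norm (v x))\<^sup>2"
    by (intro power_mono) auto
  also have "\<dots> \<le> (LINT x|M. \<bar>\<psi> x\<bar>\<^sup>2) * (LINT x|M. (norm (v x))\<^sup>2)"
    using v \<psi> by (intro CS(2)) (auto simp: L2_def)
  finally show "(norm (LINT x|M. \<psi> x *\<^sub>R v x))\<^sup>2 \<le> (LINT x|M. (\<psi> x)\<^sup>2) * nsq M v"
    by (simp add: nsq_def)
qed

lemma (in finite_measure) L2_integrable:
  fixes v :: "'a \<Rightarrow> 'v::euclidean_space"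
  assumes "L2 M v"
  shows "integrable M v"
  using L2_integral_weighted(1)[OF assms, of "\<lambda>_. 1"] by simp

text \<open>On a finite measure space an L2 Cauchy sequence is Cauchy in L1, which provides a
  subsequence converging almost everywhere; Fatou's lemma then upgrades the pointwise limit to an L2
  limit of the full sequence.\<close>

lemma (in finite_measure) Riesz_Fischer:
  fixes X :: "nat \<Rightarrow> 'a \<Rightarrow> 'v::euclidean_space"
  assumes X: "\<And>n. L2 M (X n)"
    and Cau: "\<And>e. e > 0 \<Longrightarrow> \<exists>N. \<forall>m\<ge>N. \<forall>n\<ge>N. nsq M (\<lambda>x. X m x - X n x) < e"
  obtains v where "L2 M v" "(\<lambda>n. nsq M (\<lambda>x. X n x - v x)) \<longlonglongrightarrow> 0"
proof -
  have mX [measurable]: "X n \<in> borel_measurable M" for n using X by auto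
  define \<mu> where "\<mu> = measure M (space M)"
  have L1: "\<exists>N. \<forall>i\<ge>N. \<forall>j\<ge>N. (LINT x|M. norm (X i x - X j x)) < e" if "e > 0" for e
  proof -
    have \<mu>: "0 \<le> \<mu>" by (simp add: \<mu>_def)
    \<comment> \<open>The summand 1 covers a space of measure 0.\<close>
    then have "e\<^sup>2 / (\<mu> + 1) > 0" using that by simp
    from Cau[OF this] obtain N where N: "\<And>m n. m \<ge> N \<Longrightarrow> n \<ge> N \<Longrightarrow>
      nsq M (\<lambda>x. X m x - X n x) < e\<^sup>2 / (\<mu> + 1)" by blast
    have "(LINT x|M. norm (X i x - X j x)) < e" if ij: "i \<ge> N" "j \<ge> N" for i j
    proof -
      have "(LINT x|M. 1 * norm (X i x - X j x))\<^sup>2 \<le> (LINT x|M. 1\<^sup>2) * (LINT x|M. (norm (X i x - X j x))\<^sup>2)"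
        using L2_diff[OF X X, of i j] by (intro Cauchy_Schwarz_integral(2)) (auto simp: L2_def)
      also have "\<dots> = \<mu> * nsq M (\<lambda>x. X i x - X j x)" by (simp add: nsq_def \<mu>_def)
      also have "\<dots> \<le> \<mu> * (e\<^sup>2 / (\<mu> + 1))" using N[OF ij] \<mu> by (intro mult_left_mono) auto
      also have "\<dots> < e\<^sup>2" using \<mu> \<open>e > 0\<close> by (simp add: field_simps)
      finally have "(LINT x|M. norm (X i x - X j x))\<^sup>2 < e\<^sup>2" by simp
      then show ?thesis using \<open>e > 0\<close> by (meson less_imp_le power_less_imp_less_base)
    qed
    then show ?thesis by blast
  qed
  obtain r where r: "strict_mono r" "AE x in M. Cauchy (\<lambda>i. X (r i) x)"
    using cauchy_L1_AE_cauchy_subseq[of M X, OF L2_integrable[OF X] L1] by blast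
  define v where "v x = lim (\<lambda>i. X (r i) x)" for x
  have mv [measurable]: "v \<in> borel_measurable M" unfolding v_def by measurable
  have lim: "AE x in M. (\<lambda>i. X (r i) x) \<longlonglongrightarrow> v x"
    using r(2) by eventually_elim (simp add: v_def Cauchy_convergent_iff convergent_LIMSEQ_iff)
  \<comment> \<open>Fatou is applied along the subsequence with n fixed, so the bound holds for
    every member of the original sequence.\<close>
  have bound: "L2 M (\<lambda>x. X n x - v x) \<and> nsq M (\<lambda>x. X n x - v x) \<le> e"
    if e: "e > 0" "\<And>m. m \<ge> N \<Longrightarrow> nsq M (\<lambda>x. X n x - X m x) < e" for n N e
  proof -
    have "(\<integral>\<^sup>+x. ennreal ((norm (X n x - v x))\<^sup>2) \<partial>M) =
        (\<integral>\<^sup>+x. liminf (\<lambda>i. ennreal ((norm (X n x - X (r i) x))\<^sup>2)) \<partial>M)"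
    proof (rule nn_integral_cong_AE)
      show "AE x in M. ennreal ((norm (X n x - v x))\<^sup>2) = liminf (\<lambda>i. ennreal ((norm (X n x - X (r i) x))\<^sup>2))"
        using lim
      proof eventually_elim
        case (elim x)
        then have "(\<lambda>i. ennreal ((norm (X n x - X (r i) x))\<^sup>2)) \<longlonglongrightarrow> ennreal ((norm (X n x - v x))\<^sup>2)"
          by (intro tendsto_intros)
        then show ?case by (intro lim_imp_Liminf[symmetric]) auto
      qed
    qed
    also have "\<dots> \<le> liminf (\<lambda>i. \<integral>\<^sup>+x. ennreal ((norm (X n x - X (r i) x))\<^sup>2) \<partial>M)"
      by (rule nn_integral_liminf) measurable
    also have "\<dots> \<le> liminf (\<lambda>i. ennreal e)"
    proof (rule Liminf_mono)
      show "\<forall>\<^sub>F i in sequentially. (\<integral>\<^sup>+x. ennreal ((norm (X n x - X (r i) x))\<^sup>2) \<partial>M) \<le> ennreal e"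
        using eventually_ge_at_top[of N]
      proof eventually_elim
        case (elim i)
        then have "r i \<ge> N" using seq_suble[OF r(1), of i] by linarith
        have "(\<integral>\<^sup>+x. ennreal ((norm (X n x - X (r i) x))\<^sup>2) \<partial>M) = ennreal (nsq M (\<lambda>x. X n x - X (r i) x))"
          unfolding nsq_def using L2D[OF L2_diff[OF X X]] by (intro nn_integral_eq_integral) auto
        then show ?case using e(2)[OF \<open>r i \<ge> N\<close>] by (simp add: ennreal_leI)
      qed
    qed
    finally have le: "(\<integral>\<^sup>+x. ennreal ((norm (X n x - v x))\<^sup>2) \<partial>M) \<le> ennreal e"
      by (simp add: Liminf_const)
    then have i: "integrable M (\<lambda>x. (norm (X n x - v x))\<^sup>2)"
      by (intro integrableI_bounded) (auto simp: le_less_trans[OF le])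
    have "ennreal (nsq M (\<lambda>x. X n x - v x)) \<le> ennreal e"
      unfolding nsq_def using le nn_integral_eq_integral[OF i] by simp
    then have "nsq M (\<lambda>x. X n x - v x) \<le> e" using e(1) by (simp add: ennreal_le_iff)
    then show ?thesis using i by (simp add: L2_def)
  qed
  obtain N1 where N1: "\<forall>m\<ge>N1. \<forall>n\<ge>N1. nsq M (\<lambda>x. X m x - X n x) < 1" using Cau[of 1] by auto
  have "L2 M (\<lambda>x. X N1 x - v x)" using bound[of 1 N1 N1] N1 by auto
  from L2_diff[OF X[of N1] this] have "L2 M v" by simp
  moreover have "(\<lambda>n. nsq M (\<lambda>x. X n x - v x)) \<longlonglongrightarrow> 0"
  proof (rule LIMSEQ_I)
    fix e :: real assume "e > 0"
    then obtain N where N: "\<forall>m\<ge>N. \<forall>n\<ge>N. nsq M (\<lambda>x. X m x - X n x) < e / 2" using Cau[of "e/2"] by auto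
    have "norm (nsq M (\<lambda>x. X n x - v x) - 0) < e" if "n \<ge> N" for n
    proof -
      have "nsq M (\<lambda>x. X n x - v x) \<le> e / 2" using bound[of "e/2" N n] N that \<open>e > 0\<close> by auto
      then show ?thesis using \<open>e > 0\<close> by simp
    qed
    then show "\<exists>N. \<forall>n\<ge>N. norm (nsq M (\<lambda>x. X n x - v x) - 0) < e" by blast
  qed
  ultimately show ?thesis using that by blast
qed

section \<open>Primitives of square-integrable functions on an interval\<close>

abbreviation ivl :: "real \<Rightarrow> real \<Rightarrow> real measure" where
  "ivl a b \<equiv> restrict_space lborel {a<..<b}"

lemma space_ivl [simp]: "space (ivl a b) = {a<..<b}"
  by (simp add: space_restrict_space)

lemma measurable_ivl: "f \<in> borel_measurable borel \<Longrightarrow> f \<in> borel_measurable (ivl a b)"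
  by (rule measurable_restrict_space1) simp

lemma finite_measure_ivl: "finite_measure (ivl a b)"
  by (cases "a < b") (auto intro!: finite_measureI simp: emeasure_restrict_space)

lemma measure_ivl: "a \<le> b \<Longrightarrow> measure (ivl a b) {a<..<b} = b - a"
  by (simp add: measure_restrict_space)

lemma set_LINT_ivl: "(LINT y:{a<..<b}|lborel. f y) = (LINT y|ivl a b. f y)"
  for f :: "real \<Rightarrow> 'v::euclidean_space"
  by (simp add: set_lebesgue_integral_def integral_restrict_space)

lemma square_integrable_iff_L2: "square_integrable a b u \<longleftrightarrow> L2 (ivl a b) u"
  by (simp add: square_integrable_def L2_def set_borel_measurable_def set_integrable_def
      borel_measurable_restrict_space_iff integrable_restrict_space)

lemma measurable_ivl_continuous_on:
  fixes u :: "real \<Rightarrow> 'v::euclidean_space"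
  assumes "continuous_on {a..b} u"
  shows "u \<in> borel_measurable (ivl a b)"
proof -
  have "continuous_on {a<..<b} u"
    using assms by (rule continuous_on_subset) auto
  then have "(\<lambda>x. indicator {a<..<b} x *\<^sub>R u x) \<in> borel_measurable borel"
    by (intro borel_measurable_continuous_on_indicator) auto
  then show ?thesis by (simp add: borel_measurable_restrict_space_iff)
qed

lemma L2_continuous_on:
  fixes u :: "real \<Rightarrow> 'v::euclidean_space"
  assumes "continuous_on {a..b} u"
  shows "L2 (ivl a b) u"
proof -
  interpret finite_measure "ivl a b" by (rule finite_measure_ivl)
  obtain B where B: "\<And>x. x \<in> {a..b} \<Longrightarrow> norm (u x) \<le> B"
    using compact_imp_bounded[OF compact_continuous_image[OF assms compact_Icc]]
    unfolding bounded_iff by blast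
  show ?thesis
  proof (rule L2_bound)
    show "integrable (ivl a b) (\<lambda>_. B\<^sup>2)" by simp
    show "u \<in> borel_measurable (ivl a b)" by (rule measurable_ivl_continuous_on[OF assms])
    show "(norm (u x))\<^sup>2 \<le> B\<^sup>2" if "x \<in> space (ivl a b)" for x
      using B[of x] that by (intro power_mono) auto
  qed
qed

text \<open>The cut-off sits in an integrand over a fixed interval, so the primitive is defined on
  the whole line, vanishes up to \<open>a\<close>, and is continuous there without restriction for
  square-integrable v.\<close>

definition prim :: "real \<Rightarrow> real \<Rightarrow> (real \<Rightarrow> 'v::euclidean_space) \<Rightarrow> real \<Rightarrow> 'v" where
  "prim a b v y = (LINT x|ivl a b. indicator {..y} x *\<^sub>R v x)"

text \<open>Integrating the growing exponential up to y gains 1 / \<kappa>, the small factor on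
  which the weighted estimate rests.\<close>

lemma integral_exp_weight:
  fixes \<kappa> :: real
  assumes "\<kappa> > 0"
  shows "(LINT x|ivl a b. (indicator {..y} x * exp (\<kappa> * x / 2))\<^sup>2) \<le> exp (\<kappa> * y) / \<kappa>"
proof (cases "a \<le> y")
  case True
  have "(LINT x|ivl a b. (indicator {..y} x * exp (\<kappa> * x / 2))\<^sup>2)
      = (LINT x|lborel. indicator {a<..<b} x *\<^sub>R (indicator {..y} x * exp (\<kappa> * x / 2))\<^sup>2)"
    by (simp add: integral_restrict_space)
  also have "\<dots> \<le> (LINT x|lborel. indicator {a..y} x *\<^sub>R exp (\<kappa> * x))"
  proof (rule integral_mono)
    have s: "(exp (\<kappa> * x / 2))\<^sup>2 = exp (\<kappa> * x)" for x
      by (simp add: power2_eq_square flip: exp_add)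
    have i: "integrable lborel (\<lambda>x. indicator {a..y} x *\<^sub>R exp (\<kappa> * x))"
      by (intro borel_integrable_compact continuous_intros) auto
    show "integrable lborel (\<lambda>x. indicator {a..y} x *\<^sub>R exp (\<kappa> * x))" by (rule i)
    show le: "indicator {a<..<b} x *\<^sub>R (indicator {..y} x * exp (\<kappa> * x / 2))\<^sup>2
        \<le> indicator {a..y} x *\<^sub>R exp (\<kappa> * x)" for x
      by (auto simp: indicator_def s power_mult_distrib)
    show "integrable lborel (\<lambda>x. indicator {a<..<b} x *\<^sub>R (indicator {..y} x * exp (\<kappa> * x / 2))\<^sup>2)"
      by (rule Bochner_Integration.integrable_bound[OF i])
        (use le in \<open>auto simp: abs_mult indicator_def s power_mult_distrib\<close>)
  qed
  also have "\<dots> = exp (\<kappa> * y) / \<kappa> - exp (\<kappa> * a) / \<kappa>"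
    by (rule integral_FTC_Icc[where F = "\<lambda>x. exp (\<kappa> * x) / \<kappa>"])
      (use True assms in \<open>auto intro!: derivative_eq_intros continuous_intros
        simp: has_real_derivative_iff_has_vector_derivative[symmetric]\<close>)
  also have "\<dots> \<le> exp (\<kappa> * y) / \<kappa>" using assms by simp
  finally show ?thesis .
next
  case False
  then have "(LINT x|ivl a b. (indicator {..y} x * exp (\<kappa> * x / 2))\<^sup>2) = (LINT x|ivl a b. 0)"
    by (intro Bochner_Integration.integral_cong) (auto simp: indicator_def)
  then show ?thesis using assms by simp
qed

lemma L2_exp_weight:
  assumes "L2 (ivl a b) v"
  shows "L2 (ivl a b) (\<lambda>x. exp (c * x) *\<^sub>R v x)"
proof (rule L2_bound)
  show "integrable (ivl a b) (\<lambda>x. (exp (\<bar>c\<bar> * max \<bar>a\<bar> \<bar>b\<bar>))\<^sup>2 * (norm (v x))\<^sup>2)"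
    using assms by (auto simp: L2_def)
  show "(\<lambda>x. exp (c * x) *\<^sub>R v x) \<in> borel_measurable (ivl a b)"
    by (rule borel_measurable_scaleR[OF measurable_ivl L2D(1)[OF assms]]) simp
  show "(norm (exp (c * x) *\<^sub>R v x))\<^sup>2 \<le> (exp (\<bar>c\<bar> * max \<bar>a\<bar> \<bar>b\<bar>))\<^sup>2 * (norm (v x))\<^sup>2"
    if "x \<in> space (ivl a b)" for x
  proof -
    have "c * x \<le> \<bar>c\<bar> * \<bar>x\<bar>" by (metis abs_ge_self abs_mult)
    also have "\<dots> \<le> \<bar>c\<bar> * max \<bar>a\<bar> \<bar>b\<bar>" using that by (intro mult_left_mono) auto
    finally have "exp (c * x) \<le> exp (\<bar>c\<bar> * max \<bar>a\<bar> \<bar>b\<bar>)" by simp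
    then have "(exp (c * x))\<^sup>2 * (norm (v x))\<^sup>2 \<le> (exp (\<bar>c\<bar> * max \<bar>a\<bar> \<bar>b\<bar>))\<^sup>2 * (norm (v x))\<^sup>2"
      by (intro mult_right_mono[OF power_mono]) simp_all
    then show ?thesis by (simp only: norm_scaleR power_mult_distrib power2_abs)
  qed
qed

text \<open>Cauchy-Schwarz after splitting v into exp (\<kappa> x / 2) and exp (- \<kappa> x / 2) v.
  The first factor contributes at most exp (\<kappa> y) / \<kappa>, which cancels the weight at y up
  to 1 / \<kappa>. So integration from \<open>a\<close> has small norm for large \<kappa>.\<close>

lemma prim_weighted_bound:
  assumes v: "L2 (ivl a b) v" and "\<kappa> > 0"
  shows "exp (- \<kappa> * y) * (norm (prim a b v y))\<^sup>2 \<le> nsq (ivl a b) (\<lambda>x. exp (- \<kappa> / 2 * x) *\<^sub>R v x) / \<kappa>"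
proof -
  interpret finite_measure "ivl a b" by (rule finite_measure_ivl)
  let ?v = "\<lambda>x. exp (- \<kappa> / 2 * x) *\<^sub>R v x"
  let ?\<psi> = "\<lambda>x. indicator {..y} x * exp (\<kappa> * x / 2)"
  have m: "?\<psi> \<in> borel_measurable (ivl a b)" by (rule measurable_ivl) measurable
  have "L2 (ivl a b) (\<lambda>x. exp (\<kappa> / 2 * x) *\<^sub>R (1::real))" by (rule L2_exp_weight) (simp add: L2_def)
  then have "L2 (ivl a b) ?\<psi>"
    by (intro L2_bound[where g = "\<lambda>x. (norm (exp (\<kappa> / 2 * x) *\<^sub>R (1::real)))\<^sup>2", OF _ m])
      (auto simp: L2_def power_mult_distrib indicator_def)
  then have i: "integrable (ivl a b) (\<lambda>x. (?\<psi> x)\<^sup>2)" by (simp add: L2_def)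
  have e: "exp (\<kappa> * x / 2) * exp (- (\<kappa> * x / 2)) = 1" for x by (simp flip: exp_add)
  have "prim a b v y = (LINT x|ivl a b. ?\<psi> x *\<^sub>R ?v x)"
    unfolding prim_def by (intro Bochner_Integration.integral_cong) (auto simp: e mult.assoc)
  then have "(norm (prim a b v y))\<^sup>2 \<le> (LINT x|ivl a b. (?\<psi> x)\<^sup>2) * nsq (ivl a b) ?v"
    using L2_integral_weighted(2)[OF L2_exp_weight[OF v, of "- \<kappa> / 2"] m i] by (simp only:)
  also have "\<dots> \<le> exp (\<kappa> * y) / \<kappa> * nsq (ivl a b) ?v"
    by (intro mult_right_mono integral_exp_weight assms) auto
  finally have "exp (- \<kappa> * y) * (norm (prim a b v y))\<^sup>2
      \<le> exp (- \<kappa> * y) * (exp (\<kappa> * y) / \<kappa> * nsq (ivl a b) ?v)"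
    by (intro mult_left_mono) auto
  also have "\<dots> = (exp (- \<kappa> * y) * exp (\<kappa> * y)) * (nsq (ivl a b) ?v / \<kappa>)" by simp
  also have "exp (- \<kappa> * y) * exp (\<kappa> * y) = 1" by (simp flip: exp_add)
  finally show ?thesis by simp
qed

lemma prim_diff:
  assumes "L2 (ivl a b) v" "s \<le> t"
  shows "prim a b v t - prim a b v s = (LINT x|ivl a b. indicator {s<..t} x *\<^sub>R v x)"
proof -
  interpret finite_measure "ivl a b" by (rule finite_measure_ivl)
  have i: "integrable (ivl a b) (\<lambda>x. indicator {..y} x *\<^sub>R v x)" for y
    by (rule L2_integral_weighted(1)[OF assms(1)])
      (auto intro!: measurable_ivl integrable_const_bound[where B=1] simp: indicator_def)
  show ?thesis unfolding prim_def Bochner_Integration.integral_diff[OF i i, symmetric]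
    using assms(2) by (intro Bochner_Integration.integral_cong) (auto simp: indicator_def)
qed

text \<open>Hoelder continuity of exponent 1/2 in squared form. It yields continuity of
  \<open>prim\<close> and, started at \<open>a\<close>, the pointwise bound
  \<open>prim_bound\<close>.\<close>

lemma prim_holder:
  assumes "L2 (ivl a b) v" "s \<le> t"
  shows "(norm (prim a b v t - prim a b v s))\<^sup>2 \<le> (t - s) * nsq (ivl a b) v"
proof -
  interpret finite_measure "ivl a b" by (rule finite_measure_ivl)
  have i: "integrable (ivl a b) (\<lambda>x. (indicat_real {s<..t} x)\<^sup>2)"
    by (auto intro!: measurable_ivl integrable_const_bound[where B=1] simp: indicator_def)
  have "(norm (prim a b v t - prim a b v s))\<^sup>2
      \<le> (LINT x|ivl a b. (indicat_real {s<..t} x)\<^sup>2) * nsq (ivl a b) v"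
    unfolding prim_diff[OF assms]
    by (rule L2_integral_weighted(2)[OF assms(1) _ i]) (rule measurable_ivl, measurable)
  also have "\<dots> \<le> (t - s) * nsq (ivl a b) v"
  proof (rule mult_right_mono)
    have "(LINT x|ivl a b. (indicat_real {s<..t} x)\<^sup>2) =
        (LINT x|lborel. indicat_real ({a<..<b} \<inter> {s<..t}) x)"
      unfolding integral_restrict_space[of "{a<..<b}" lborel, simplified]
      by (intro Bochner_Integration.integral_cong) (auto simp: indicator_def)
    also have "\<dots> = measure lborel ({a<..<b} \<inter> {s<..t})" by simp
    also have "\<dots> \<le> measure lborel {s<..t}" by (rule measure_mono_fmeasurable) (auto simp: assms fmeasurable_def)
    also have "\<dots> = t - s" using assms by simp
    finally show "(LINT x|ivl a b. (indicat_real {s<..t} x)\<^sup>2) \<le> t - s" .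
  qed simp
  finally show ?thesis .
qed

lemma prim_le_a: "y \<le> a \<Longrightarrow> prim a b v y = 0"
  unfolding prim_def
  by (rule integral_eq_zero_AE) (auto simp: indicator_def intro!: AE_I2)

lemma prim_bound:
  assumes "L2 (ivl a b) v" "y \<in> {a..b}"
  shows "(norm (prim a b v y))\<^sup>2 \<le> (b - a) * nsq (ivl a b) v"
proof -
  have "(norm (prim a b v y))\<^sup>2 \<le> (y - a) * nsq (ivl a b) v"
    using prim_holder[OF assms(1), of a y] assms(2) by (simp add: prim_le_a)
  also have "\<dots> \<le> (b - a) * nsq (ivl a b) v" using assms(2) by (intro mult_right_mono) auto
  finally show ?thesis .
qed

lemma continuous_on_prim:
  assumes v: "L2 (ivl a b) v"
  shows "continuous_on A (prim a b v)"
proof (intro continuous_at_imp_continuous_on ballI)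
  fix x
  have "(norm (prim a b v y - prim a b v x))\<^sup>2 \<le> \<bar>y - x\<bar> * nsq (ivl a b) v" for y
    using prim_holder[OF v, of x y] prim_holder[OF v, of y x]
    by (cases "x \<le> y") (simp_all add: norm_minus_commute)
  then have le: "norm (prim a b v y - prim a b v x) \<le> sqrt (\<bar>y - x\<bar> * nsq (ivl a b) v)" for y
    by (rule real_le_rsqrt)
  have "((\<lambda>y. sqrt (\<bar>y - x\<bar> * nsq (ivl a b) v)) \<longlongrightarrow> sqrt (\<bar>x - x\<bar> * nsq (ivl a b) v)) (at x)"
    by (intro tendsto_intros)
  then have lim: "((\<lambda>y. sqrt (\<bar>y - x\<bar> * nsq (ivl a b) v)) \<longlongrightarrow> 0) (at x)" by simp
  have "((\<lambda>y. prim a b v y - prim a b v x) \<longlongrightarrow> 0) (at x)"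
    by (rule Lim_null_comparison[OF always_eventually lim]) (rule allI le)+
  then show "isCont (prim a b v) x" unfolding isCont_def by (simp add: LIM_zero_iff)
qed

lemma prim_sub:
  assumes "L2 (ivl a b) v" "L2 (ivl a b) w"
  shows "prim a b (\<lambda>x. v x - w x) y = prim a b v y - prim a b w y"
proof -
  interpret finite_measure "ivl a b" by (rule finite_measure_ivl)
  have i: "integrable (ivl a b) (\<lambda>x. indicator {..y} x *\<^sub>R u x)" if "L2 (ivl a b) u" for u
    by (rule L2_integral_weighted(1)[OF that])
      (auto intro!: measurable_ivl integrable_const_bound[where B=1] simp: indicator_def)
  show ?thesis unfolding prim_def scaleR_diff_right
    by (rule Bochner_Integration.integral_diff[OF i i]) (rule assms)+
qed

section \<open>Piecewise quadratic test functions\<close>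

text \<open>The truncated square has a continuous derivative, just enough for a C^1 test
  function.\<close>

definition ramp_sq :: "real \<Rightarrow> real" where "ramp_sq x = (max 0 x)\<^sup>2"

lemma DERIV_ramp_sq: "(ramp_sq has_real_derivative 2 * max 0 x) (at x)"
proof -
  consider "x < 0" | "x = 0" | "x > 0" by linarith
  then show ?thesis
  proof cases
    case 1
    have "((\<lambda>_. 0) has_real_derivative 2 * max 0 x) (at x)" using 1 by simp
    then show ?thesis
      by (rule has_field_derivative_transform_within_open[of _ _ _ "{..<0}"])
        (use 1 in \<open>auto simp: ramp_sq_def\<close>)
  next
    case 2
    have "(\<lambda>h. (ramp_sq h - ramp_sq 0) / h) \<midarrow>0\<rightarrow> 0"
    proof (rule Lim_null_comparison)
      show "\<forall>\<^sub>F h in at 0. norm ((ramp_sq h - ramp_sq 0) / h) \<le> \<bar>h\<bar>"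
        by (intro always_eventually allI) (auto simp: ramp_sq_def max_def power2_eq_square)
      show "((\<lambda>h::real. \<bar>h\<bar>) \<longlongrightarrow> 0) (at 0)" using tendsto_rabs[OF tendsto_ident_at, of 0 UNIV] by simp
    qed
    then show ?thesis using 2 by (simp add: DERIV_def)
  next
    case 3
    have "((\<lambda>y. y\<^sup>2) has_real_derivative 2 * max 0 x) (at x)"
      using 3 by (auto intro!: derivative_eq_intros)
    then show ?thesis
      by (rule has_field_derivative_transform_within_open[of _ _ _ "{0<..}"])
        (use 3 in \<open>auto simp: ramp_sq_def\<close>)
  qed
qed

text \<open>Second difference of truncated squares with knots 0, 1/2, 1. Beyond 1 the quadratic and
  linear parts cancel and leave 1/2, which the factor 2 normalizes to 1.\<close>

definition c1step :: "real \<Rightarrow> real" where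
  "c1step x = 2 * (ramp_sq x - 2 * ramp_sq (x - 1/2) + ramp_sq (x - 1))"

text \<open>The derivative of \<open>c1step\<close>: the tent on [0,1] with peak 2 at 1/2 and unit
  area.\<close>

definition hat :: "real \<Rightarrow> real" where
  "hat x = 4 * (max 0 x - 2 * max 0 (x - 1/2) + max 0 (x - 1))"

lemma c1step_eq_0: "x \<le> 0 \<Longrightarrow> c1step x = 0"
  by (simp add: c1step_def ramp_sq_def)

lemma c1step_eq_1: "x \<ge> 1 \<Longrightarrow> c1step x = 1"
  by (simp add: c1step_def ramp_sq_def power2_eq_square algebra_simps)

lemma c1step_bounds: "0 \<le> c1step x \<and> c1step x \<le> 1"
proof -
  consider "x \<le> 0" | "0 \<le> x" "x \<le> 1/2" | "1/2 \<le> x" "x \<le> 1" | "1 \<le> x" by linarith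
  then show ?thesis
  proof cases
    case 2
    then have "c1step x = 2 * x\<^sup>2" "x\<^sup>2 \<le> (1/2)\<^sup>2"
      by (auto simp: c1step_def ramp_sq_def intro!: power_mono)
    then show ?thesis by (simp add: power2_eq_square)
  next
    case 3
    then have "c1step x = 1 - 2 * (1 - x)\<^sup>2" "(1 - x)\<^sup>2 \<le> (1/2)\<^sup>2"
      by (auto simp: c1step_def ramp_sq_def power2_eq_square algebra_simps intro!: power_mono)
        (use mult_mono[of "1 - x" "1/2" "1 - x" "1/2"] in \<open>auto simp: algebra_simps\<close>)
    moreover have "0 \<le> (1 - x)\<^sup>2" by simp
    ultimately show ?thesis by (simp add: power2_eq_square)
  qed (simp_all add: c1step_eq_0 c1step_eq_1)
qed

lemma hat_eq_0: "x \<notin> {0..1} \<Longrightarrow> hat x = 0"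
  by (auto simp: hat_def max_def)

lemma hat_bounds: "0 \<le> hat x \<and> hat x \<le> 2"
  by (auto simp: hat_def max_def)

lemma continuous_on_hat: "continuous_on A hat"
  unfolding hat_def by (intro continuous_intros)

lemma DERIV_c1step: "(c1step has_real_derivative hat x) (at x)"
  unfolding c1step_def hat_def
  by (auto intro!: derivative_eq_intros DERIV_chain2[OF DERIV_ramp_sq])

lemma integral_hat: "(LINT z|lborel. indicator {0..1} z *\<^sub>R hat z) = 1"
proof -
  have "(LINT z|lborel. indicator {0..1} z *\<^sub>R hat z) = c1step 1 - c1step 0"
    by (rule integral_FTC_Icc)
      (use DERIV_c1step in \<open>auto simp: continuous_on_hat has_real_derivative_iff_has_vector_derivative
        intro: has_vector_derivative_at_within\<close>)
  then show ?thesis by (simp add: c1step_eq_0 c1step_eq_1)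
qed

text \<open>Tends to the indicator function of \<open>{s<..t}\<close> as \<open>\<delta>\<close> decreases to 0.\<close>

definition plateau :: "real \<Rightarrow> real \<Rightarrow> real \<Rightarrow> real \<Rightarrow> real" where
  "plateau \<delta> s t y = c1step ((y - s) / \<delta>) - c1step ((y - t) / \<delta>)"

lemma DERIV_plateau:
  assumes "\<delta> > 0"
  shows "(plateau \<delta> s t has_real_derivative hat ((y - s) / \<delta>) / \<delta> - hat ((y - t) / \<delta>) / \<delta>) (at y)"
  unfolding plateau_def using assms
  by (auto intro!: derivative_eq_intros DERIV_chain2[OF DERIV_c1step])

lemma plateau_support:
  assumes "\<delta> > 0" "s \<le> t" "plateau \<delta> s t y \<noteq> 0"
  shows "y \<in> {s..t + \<delta>}"
proof (rule ccontr)
  assume "y \<notin> {s..t + \<delta>}"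
  then consider "y < s" | "y > t + \<delta>" by force
  then have "plateau \<delta> s t y = 0"
  proof cases
    case 1
    then show ?thesis using assms by (simp add: plateau_def c1step_eq_0 divide_nonpos_pos)
  next
    case 2
    then have "(y - s) / \<delta> \<ge> 1" "(y - t) / \<delta> \<ge> 1" using assms by (simp_all add: field_simps)
    then show ?thesis by (simp add: plateau_def c1step_eq_1)
  qed
  then show False using assms by simp
qed

lemma plateau_abs_le: "\<bar>plateau \<delta> s t y\<bar> \<le> 1"
  using c1step_bounds[of "(y - s) / \<delta>"] c1step_bounds[of "(y - t) / \<delta>"]
  unfolding plateau_def by linarith

lemma test_function_plateau:
  assumes "a < s" "s \<le> t" "t + \<delta> < b" "\<delta> > 0"
  shows "test_function a b (plateau \<delta> s t)"
  unfolding test_function_def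
proof
  show "plateau \<delta> s t C1_differentiable_on UNIV"
    unfolding C1_differentiable_on_def
  proof (intro exI conjI ballI)
    show "(plateau \<delta> s t has_vector_derivative hat ((y - s) / \<delta>) / \<delta> - hat ((y - t) / \<delta>) / \<delta>) (at y)" for y
      using DERIV_plateau[OF assms(4)] by (simp add: has_real_derivative_iff_has_vector_derivative)
    show "continuous_on UNIV (\<lambda>y. hat ((y - s) / \<delta>) / \<delta> - hat ((y - t) / \<delta>) / \<delta>)"
      by (intro continuous_intros continuous_on_compose2[OF continuous_on_hat[of UNIV]]) (use assms in auto)
  qed
  have "closure {y. plateau \<delta> s t y \<noteq> 0} \<subseteq> {s..t + \<delta>}"
    using plateau_support[OF assms(4,2)] by (intro closure_minimal) auto
  then show "closure {y. plateau \<delta> s t y \<noteq> 0} \<subseteq> {a<..<b}" using assms by force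
qed

lemma tendsto_scale_seq: "(\<lambda>n. c / (real n + 1)) \<longlonglongrightarrow> 0"
  using tendsto_mult[OF tendsto_const[of c] LIMSEQ_inverse_real_of_nat] by (simp add: divide_inverse add.commute)

text \<open>Since \<open>c1step\<close> vanishes at 0, the limit at x = 0 is 0; hence the limits of
  plateaus are indicators of intervals open on the left.\<close>

lemma c1step_rescale_tendsto:
  assumes "c > 0"
  shows "(\<lambda>n. c1step (x / (c / (real n + 1)))) \<longlonglongrightarrow> (if x > 0 then 1 else 0)"
proof (cases "x > 0")
  case True
  obtain N :: nat where N: "c / x < real N" using reals_Archimedean2 by blast
  have "\<forall>\<^sub>F n in sequentially. c1step (x / (c / (real n + 1))) = 1"
    using eventually_ge_at_top[of N]
  proof eventually_elim
    case (elim n)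
    have "c / x < real n + 1" using N elim by linarith
    then have "x / (c / (real n + 1)) \<ge> 1" using True assms by (simp add: field_simps)
    then show ?case by (rule c1step_eq_1)
  qed
  then show ?thesis using True by (simp add: tendsto_eventually)
next
  case False
  then have "x / (c / (real n + 1)) \<le> 0" for n using assms by (intro divide_nonpos_pos) auto
  then show ?thesis using False by (simp add: c1step_eq_0)
qed

lemma tendsto_integral_plateau:
  fixes v :: "real \<Rightarrow> 'v::euclidean_space"
  assumes v: "locally_integrable a b v" and st: "a < s" "s \<le> t" "t + c < b" "c > 0"
  shows "(\<lambda>n. LINT y|ivl a b. plateau (c / (real n + 1)) s t y *\<^sub>R v y)
     \<longlonglongrightarrow> (LINT y|lborel. indicator {s<..t} y *\<^sub>R v y)"
proof -
  let ?p = "\<lambda>n. plateau (c / (real n + 1)) s t"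
  \<comment> \<open>\<open>v\<close> is only locally integrable. All plateaus are supported in this
    compact subinterval of (a,b), on which \<open>v\<close> is integrable and serves as
    majorant.\<close>
  let ?v = "\<lambda>y. indicator {s..t + c} y *\<^sub>R v y"
  have iv: "integrable lborel ?v"
    using v st by (auto simp: locally_integrable_def set_integrable_def)
  have supp: "?p n y = 0" if "y \<notin> {s..t + c}" for n y
  proof (rule ccontr)
    assume "?p n y \<noteq> 0"
    moreover have "c / (real n + 1) \<le> c" "c / (real n + 1) > 0" using st by (simp_all add: field_simps)
    ultimately show False using plateau_support[of "c / (real n + 1)" s t y] st that by auto
  qed
  have eq: "(LINT y|ivl a b. ?p n y *\<^sub>R v y) = (LINT y|lborel. ?p n y *\<^sub>R ?v y)" for n
  proof -
    have "(LINT y|ivl a b. ?p n y *\<^sub>R v y) = (LINT y|lborel. indicator {a<..<b} y *\<^sub>R (?p n y *\<^sub>R v y))"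
      by (simp add: integral_restrict_space)
    also have "\<dots> = (LINT y|lborel. ?p n y *\<^sub>R ?v y)"
    proof (intro Bochner_Integration.integral_cong refl)
      fix y
      show "indicator {a<..<b} y *\<^sub>R (?p n y *\<^sub>R v y) = ?p n y *\<^sub>R ?v y"
        using supp[of y n] st by (cases "y \<in> {s..t + c}") auto
    qed
    finally show ?thesis .
  qed
  have cp: "continuous_on UNIV (?p n)" for n
    using DERIV_plateau[of "c / (real n + 1)" s t] st
    by (intro continuous_at_imp_continuous_on ballI DERIV_isCont) auto
  have eq2: "(LINT y|lborel. indicator {s<..t} y *\<^sub>R v y) = (LINT y|lborel. indicator {s<..t} y *\<^sub>R ?v y)"
    using st by (intro Bochner_Integration.integral_cong) (auto simp: indicator_def)
  show ?thesis unfolding eq eq2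
  proof (rule integral_dominated_convergence[where w = "\<lambda>y. norm (?v y)"])
    show "integrable lborel (\<lambda>y. norm (?v y))" by (rule integrable_norm[OF iv])
    show "(\<lambda>y. ?p n y *\<^sub>R ?v y) \<in> borel_measurable lborel" for n
      using borel_measurable_continuous_onI[OF cp] iv
      by (intro borel_measurable_scaleR borel_measurable_integrable[OF iv]) simp
    show "(\<lambda>y. indicator {s<..t} y *\<^sub>R ?v y) \<in> borel_measurable lborel"
      by (intro borel_measurable_scaleR borel_measurable_integrable[OF iv]) simp
    show "AE y in lborel. norm (?p n y *\<^sub>R ?v y) \<le> norm (?v y)" for n
      unfolding norm_scaleR[of "?p n _"] real_norm_def
      by (intro AE_I2 mult_left_le_one_le norm_ge_zero abs_ge_zero plateau_abs_le)
    show "AE y in lborel. (\<lambda>n. ?p n y *\<^sub>R ?v y) \<longlonglongrightarrow> indicator {s<..t} y *\<^sub>R ?v y"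
    proof (intro AE_I2 tendsto_scaleR tendsto_const)
      fix y
      have "(\<lambda>n. ?p n y) \<longlonglongrightarrow> (if y - s > 0 then 1 else 0) - (if y - t > 0 then 1 else 0)"
        unfolding plateau_def using st by (intro tendsto_diff c1step_rescale_tendsto)
      also have "(if y - s > 0 then 1 else 0) - (if y - t > 0 then 1 else 0) = indicat_real {s<..t} y"
        using st by (auto simp: indicator_def)
      finally show "(\<lambda>n. ?p n y) \<longlonglongrightarrow> indicat_real {s<..t} y" .
    qed
  qed
qed

text \<open>The rescaled hats are a one-sided approximate identity at s. The substitution y = s +
  \<delta> z moves the concentration from the kernel into the argument of the continuous function u,
  and dominated convergence applies.\<close>

lemma tendsto_integral_hat:
  fixes u :: "real \<Rightarrow> 'v::euclidean_space"
  assumes u: "continuous_on {a..b} u" and st: "a < s" "s + c < b" "c > 0"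
  shows "integrable (ivl a b) (\<lambda>y. (hat ((y - s) / c) / c) *\<^sub>R u y)"
    and "(\<lambda>n. LINT y|ivl a b. (hat ((y - s) / (c / (real n + 1))) / (c / (real n + 1))) *\<^sub>R u y) \<longlonglongrightarrow> u s"
proof -
  interpret finite_measure "ivl a b" by (rule finite_measure_ivl)
  have "continuous_on {a..b} (\<lambda>y. (hat ((y - s) / c) / c) *\<^sub>R u y)"
    by (intro continuous_intros u continuous_on_compose2[OF continuous_on_hat[of UNIV]]) (use st in auto)
  then show "integrable (ivl a b) (\<lambda>y. (hat ((y - s) / c) / c) *\<^sub>R u y)"
    by (intro L2_integrable L2_continuous_on)
  define \<delta> where "\<delta> n = c / (real n + 1)" for n
  have \<delta>: "\<delta> n > 0" "\<delta> n \<le> c" for n using st by (simp_all add: \<delta>_def field_simps)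
  have mem: "s + \<delta> n * z \<in> {a<..<b}" if "z \<in> {0..1}" for n z
  proof -
    have "\<delta> n * z \<le> c * 1" "0 \<le> \<delta> n * z" using \<delta>[of n] that by (auto intro!: mult_mono simp del: mult_1_right)
    then show ?thesis using st by auto
  qed
  have eq: "(LINT y|ivl a b. (hat ((y - s) / \<delta> n) / \<delta> n) *\<^sub>R u y)
      = (LINT z|lborel. indicator {0..1} z *\<^sub>R (hat z *\<^sub>R u (s + \<delta> n * z)))" for n
  proof -
    have "(LINT y|ivl a b. (hat ((y - s) / \<delta> n) / \<delta> n) *\<^sub>R u y)
        = (LINT y|lborel. indicator {a<..<b} y *\<^sub>R ((hat ((y - s) / \<delta> n) / \<delta> n) *\<^sub>R u y))"
      by (simp add: integral_restrict_space)
    also have "\<dots> = \<bar>\<delta> n\<bar> *\<^sub>R (LINT z|lborel. indicator {a<..<b} (s + \<delta> n * z) *\<^sub>R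
        ((hat ((s + \<delta> n * z - s) / \<delta> n) / \<delta> n) *\<^sub>R u (s + \<delta> n * z)))"
      by (rule lborel_integral_real_affine) (use \<delta>[of n] in simp)
    also have "\<dots> = (LINT z|lborel. \<bar>\<delta> n\<bar> *\<^sub>R (indicator {a<..<b} (s + \<delta> n * z) *\<^sub>R
        ((hat ((s + \<delta> n * z - s) / \<delta> n) / \<delta> n) *\<^sub>R u (s + \<delta> n * z))))"
      by (rule integral_scaleR_right[symmetric])
    also have "\<dots> = (LINT z|lborel. indicator {0..1} z *\<^sub>R (hat z *\<^sub>R u (s + \<delta> n * z)))"
    proof (intro Bochner_Integration.integral_cong refl)
      fix z
      show "\<bar>\<delta> n\<bar> *\<^sub>R (indicator {a<..<b} (s + \<delta> n * z) *\<^sub>R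
        ((hat ((s + \<delta> n * z - s) / \<delta> n) / \<delta> n) *\<^sub>R u (s + \<delta> n * z)))
        = indicator {0..1} z *\<^sub>R (hat z *\<^sub>R u (s + \<delta> n * z))"
        using \<delta>[of n] mem[of z n] hat_eq_0[of z] by (cases "z \<in> {0..1}") auto
    qed
    finally show ?thesis .
  qed
  obtain B where B: "\<And>x. x \<in> {a..b} \<Longrightarrow> norm (u x) \<le> B"
    using compact_imp_bounded[OF compact_continuous_image[OF u compact_Icc]]
    unfolding bounded_iff by blast
  have meas: "(\<lambda>z. indicator {0..1} z *\<^sub>R (hat z *\<^sub>R w z)) \<in> borel_measurable borel"
    if "continuous_on {0..1} w" for w :: "real \<Rightarrow> 'v"
    using that by (intro borel_measurable_continuous_on_indicator continuous_intros continuous_on_hat) auto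
  have "(\<lambda>n. LINT z|lborel. indicator {0..1} z *\<^sub>R (hat z *\<^sub>R u (s + \<delta> n * z)))
      \<longlonglongrightarrow> (LINT z|lborel. indicator {0..1} z *\<^sub>R (hat z *\<^sub>R u s))"
  proof (rule integral_dominated_convergence[where w = "\<lambda>z. indicator {0..1::real} z *\<^sub>R (2 * B)"])
    show "integrable lborel (\<lambda>z. indicator {0..1::real} z *\<^sub>R (2 * B))"
      by (rule borel_integrable_compact) (auto intro!: continuous_intros)
    show "(\<lambda>z. indicator {0..1} z *\<^sub>R (hat z *\<^sub>R u s)) \<in> borel_measurable lborel"
      using meas[of "\<lambda>_. u s"] by simp
    show "(\<lambda>z. indicator {0..1} z *\<^sub>R (hat z *\<^sub>R u (s + \<delta> n * z))) \<in> borel_measurable lborel" for n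
    proof -
      have "continuous_on {0..1} (\<lambda>z. u (s + \<delta> n * z))"
        using mem[of _ n] by (intro continuous_on_compose2[OF u] continuous_intros) (fastforce simp: less_imp_le)
      then show ?thesis using meas by simp
    qed
    show "AE z in lborel. norm (indicator {0..1} z *\<^sub>R (hat z *\<^sub>R u (s + \<delta> n * z))) \<le> indicator {0..1} z *\<^sub>R (2 * B)" for n
    proof (intro AE_I2)
      fix z
      show "norm (indicator {0..1} z *\<^sub>R (hat z *\<^sub>R u (s + \<delta> n * z))) \<le> indicator {0..1} z *\<^sub>R (2 * B)"
      proof (cases "z \<in> {0..1}")
        case True
        have "\<bar>hat z\<bar> * norm (u (s + \<delta> n * z)) \<le> 2 * B"
          using hat_bounds[of z] B[of "s + \<delta> n * z"] mem[OF True, of n] by (intro mult_mono) auto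
        then show ?thesis using True by simp
      qed simp
    qed
    show "AE z in lborel. (\<lambda>n. indicator {0..1} z *\<^sub>R (hat z *\<^sub>R u (s + \<delta> n * z))) \<longlonglongrightarrow> indicator {0..1} z *\<^sub>R (hat z *\<^sub>R u s)"
    proof (intro AE_I2)
      fix z :: real
      show "(\<lambda>n. indicator {0..1} z *\<^sub>R (hat z *\<^sub>R u (s + \<delta> n * z))) \<longlonglongrightarrow> indicator {0..1} z *\<^sub>R (hat z *\<^sub>R u s)"
      proof (cases "z \<in> {0..1}")
        case True
        have "(\<lambda>n. s + \<delta> n * z) \<longlonglongrightarrow> s + 0 * z"
          unfolding \<delta>_def by (intro tendsto_intros tendsto_scale_seq)
        then have "(\<lambda>n. u (s + \<delta> n * z)) \<longlonglongrightarrow> u s"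
          using st mem[OF True]
          by (intro continuous_on_tendsto_compose[OF u] always_eventually allI) (auto dest: less_imp_le)
        then show ?thesis by (intro tendsto_intros)
      qed simp
    qed
  qed
  also have "(LINT z|lborel. indicator {0..1} z *\<^sub>R (hat z *\<^sub>R u s)) = u s"
  proof -
    have "integrable lborel (\<lambda>z. indicator {0..1} z *\<^sub>R hat z)"
      by (rule borel_integrable_compact) (auto intro!: continuous_on_hat)
    then have "(LINT z|lborel. (indicator {0..1} z *\<^sub>R hat z) *\<^sub>R u s) = 1 *\<^sub>R u s"
      by (subst integral_scaleR_left) (simp_all add: integral_hat[simplified])
    then show ?thesis by (simp add: mult.assoc)
  qed
  finally show "(\<lambda>n. LINT y|ivl a b. (hat ((y - s) / (c / (real n + 1))) / (c / (real n + 1))) *\<^sub>R u y) \<longlonglongrightarrow> u s"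
    unfolding eq[symmetric] by (simp only: \<delta>_def)
qed

section \<open>Weak derivatives of continuous functions\<close>

text \<open>The derivative of a plateau is a hat near s minus a hat near t. Testing with it and
  shrinking the width turns one side of the weak formulation into u s - u t and the other into minus
  the integral of v.\<close>

lemma weak_derivative_increment:
  fixes u v :: "real \<Rightarrow> 'v::euclidean_space"
  assumes w: "has_weak_derivative a b u v" and u: "continuous_on {a..b} u"
    and st: "a < s" "s \<le> t" "t < b"
  shows "u t - u s = (LINT y|lborel. indicator {s<..t} y *\<^sub>R v y)"
proof -
  \<comment> \<open>Room for the right flank of the plateaus, which extends beyond t by at most
    c.\<close>
  define c where "c = (b - t) / 2"
  have c: "c > 0" "t + c < b" "s + c < b" using st by (simp_all add: c_def field_simps)
  define \<delta> where "\<delta> n = c / (real n + 1)" for n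
  have \<delta>: "\<delta> n > 0" "\<delta> n \<le> c" for n using c by (simp_all add: \<delta>_def field_simps)
  let ?h = "\<lambda>n r y. (hat ((y - r) / \<delta> n) / \<delta> n) *\<^sub>R u y"
  have dist: "(LINT y|ivl a b. ?h n s y) - (LINT y|ivl a b. ?h n t y)
      = - (LINT y|ivl a b. plateau (\<delta> n) s t y *\<^sub>R v y)" for n
  proof -
    have "test_function a b (plateau (\<delta> n) s t)"
      using st c \<delta>[of n] by (intro test_function_plateau) auto
    then have "(LINT y|ivl a b. deriv (plateau (\<delta> n) s t) y *\<^sub>R u y)
        = - (LINT y|ivl a b. plateau (\<delta> n) s t y *\<^sub>R v y)"
      using w by (auto simp: has_weak_derivative_def set_LINT_ivl)
    moreover have "deriv (plateau (\<delta> n) s t) y *\<^sub>R u y = ?h n s y - ?h n t y" for y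
      using DERIV_imp_deriv[OF DERIV_plateau[OF \<delta>(1)[of n]]] by (simp add: scaleR_diff_left)
    moreover have "(LINT y|ivl a b. ?h n s y - ?h n t y) = (LINT y|ivl a b. ?h n s y) - (LINT y|ivl a b. ?h n t y)"
      using st c \<delta>[of n]
      by (intro Bochner_Integration.integral_diff tendsto_integral_hat(1)[OF u]) auto
    ultimately show ?thesis by simp
  qed
  have "(\<lambda>n. (LINT y|ivl a b. ?h n s y) - (LINT y|ivl a b. ?h n t y)) \<longlonglongrightarrow> u s - u t"
    unfolding \<delta>_def using st c by (intro tendsto_diff tendsto_integral_hat(2)[OF u]) auto
  moreover have "(\<lambda>n. - (LINT y|ivl a b. plateau (\<delta> n) s t y *\<^sub>R v y))
      \<longlonglongrightarrow> - (LINT y|lborel. indicator {s<..t} y *\<^sub>R v y)"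
    unfolding \<delta>_def using w st c
    by (intro tendsto_minus tendsto_integral_plateau) (auto simp: has_weak_derivative_def)
  ultimately have "u s - u t = - (LINT y|lborel. indicator {s<..t} y *\<^sub>R v y)"
    unfolding dist by (rule LIMSEQ_unique)
  then show ?thesis by (metis minus_diff_eq minus_minus)
qed

text \<open>The half-lines form an intersection-stable generator of the Borel sets, and the sets
  over which f integrates to 0 form a Dynkin system; the vanishing total integral handles
  complements.\<close>

lemma AE_eq_0_of_tail_integrals:
  fixes f :: "real \<Rightarrow> 'v::euclidean_space"
  assumes f: "integrable lborel f" and z: "integral\<^sup>L lborel f = 0"
    and tail: "\<And>x. (LINT y|lborel. indicator {x<..} y *\<^sub>R f y) = 0"
  shows "AE y in lborel. f y = 0"
proof (rule sigma_finite_measure.density_zero[OF sigma_finite_lborel f])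
  fix A assume "A \<in> sets (lborel :: real measure)"
  then have A: "A \<in> sigma_sets UNIV (range (\<lambda>x::real. {x<..}))" by (simp add: borel_Ioi)
  have "Int_stable (range (\<lambda>x::real. {x<..}))" "range (\<lambda>x::real. {x<..}) \<subseteq> Pow UNIV"
    by (auto simp: Int_stable_def lessThan_Int_lessThan)
  from this A show "set_lebesgue_integral lborel A f = 0"
  proof (induct rule: sigma_sets_induct_disjoint)
    fix B assume "B \<in> range (\<lambda>x::real. {x<..})"
    then show "set_lebesgue_integral lborel B f = 0" using tail by (auto simp: set_lebesgue_integral_def)
  next
    show "set_lebesgue_integral lborel {} f = 0" by (simp add: set_lebesgue_integral_def)
  next
    fix B assume B: "B \<in> sigma_sets UNIV (range (\<lambda>x::real. {x<..}))" "set_lebesgue_integral lborel B f = 0"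
    then have "B \<in> sets lborel" by (simp add: borel_Ioi)
    then have i: "integrable lborel (\<lambda>x. indicator B x *\<^sub>R f x)" by (intro integrable_mult_indicator f)
    have "set_lebesgue_integral lborel (UNIV - B) f = (LINT x|lborel. f x - indicator B x *\<^sub>R f x)"
      unfolding set_lebesgue_integral_def by (intro Bochner_Integration.integral_cong) (auto simp: indicator_def)
    also have "\<dots> = 0" using B z f i by (simp add: set_lebesgue_integral_def)
    finally show "set_lebesgue_integral lborel (UNIV - B) f = 0" .
  next
    fix B :: "nat \<Rightarrow> real set"
    assume B: "disjoint_family B" "range B \<subseteq> sigma_sets UNIV (range (\<lambda>x::real. {x<..}))"
      "\<And>i. set_lebesgue_integral lborel (B i) f = 0"
    then have m: "B i \<in> sets lborel" for i by (auto simp: borel_Ioi)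
    have "set_lebesgue_integral lborel (\<Union>i. B i) f = (\<Sum>i. set_lebesgue_integral lborel (B i) f)"
      by (rule lebesgue_integral_countable_add)
        (use m B(1) f in \<open>auto simp: disjoint_family_on_def set_integrable_def
          intro!: integrable_mult_indicator\<close>)
    then show "set_lebesgue_integral lborel (\<Union>i. B i) f = 0" using B(3) by simp
  qed
qed

lemma AE_eq_of_interval_integrals:
  fixes v w :: "real \<Rightarrow> 'v::euclidean_space"
  assumes v: "locally_integrable a b v" and w: "locally_integrable a b w"
    and eq: "\<And>s t. a < s \<Longrightarrow> s \<le> t \<Longrightarrow> t < b \<Longrightarrow>
      (LINT y|lborel. indicator {s<..t} y *\<^sub>R v y) = (LINT y|lborel. indicator {s<..t} y *\<^sub>R w y)"
  shows "AE y in ivl a b. v y = w y"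
proof -
  have ii: "integrable lborel (\<lambda>y. indicator {s<..t} y *\<^sub>R z y)"
    if "locally_integrable a b z" "a < s" "t < b" for z :: "real \<Rightarrow> 'v" and s t
  proof -
    have "set_integrable lborel {s..t} z" using that by (auto simp: locally_integrable_def)
    then have "set_integrable lborel {s<..t} z" by (rule set_integrable_subset) auto
    then show ?thesis by (simp add: set_integrable_def)
  qed
  have loc: "AE y in lborel. indicator {s<..t} y *\<^sub>R (v y - w y) = 0" if st: "a < s" "t < b" for s t
  proof (rule AE_eq_0_of_tail_integrals)
    have z: "(LINT y|lborel. indicator {s'<..t} y *\<^sub>R (v y - w y)) = 0" if "a < s'" for s'
    proof (cases "s' \<le> t")
      case True
      then show ?thesis using eq[of s' t] ii[OF v, of s' t] ii[OF w, of s' t] st that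
        by (simp add: scaleR_diff_right)
    qed simp
    show "integrable lborel (\<lambda>y. indicator {s<..t} y *\<^sub>R (v y - w y))"
      using ii[OF v] ii[OF w] st by (simp add: scaleR_diff_right)
    show "(LINT y|lborel. indicator {s<..t} y *\<^sub>R (v y - w y)) = 0" using z st by simp
    show "(LINT y|lborel. indicator {x<..} y *\<^sub>R indicator {s<..t} y *\<^sub>R (v y - w y)) = 0" for x
    proof -
      \<comment> \<open>Intersecting with a half-line only moves the left end to max x s, which
        still exceeds a.\<close>
      have "(\<lambda>y. indicator {x<..} y *\<^sub>R indicator {s<..t} y *\<^sub>R (v y - w y))
          = (\<lambda>y. indicator {max x s<..t} y *\<^sub>R (v y - w y))"
        by (auto simp: indicator_def)
      then show ?thesis using z[of "max x s"] st by (simp only: less_max_iff_disj simp_thms)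
    qed
  qed
  \<comment> \<open>Local integrability settles compact subintervals only; countably many of them
    exhaust (a,b), so the exceptional null sets can be united.\<close>
  have "AE y in lborel. \<forall>n::nat. indicator {a + 1 / (real n + 1)<..b - 1 / (real n + 1)} y *\<^sub>R (v y - w y) = 0"
    unfolding AE_all_countable by (intro allI loc) simp_all
  then have "AE y in lborel. y \<in> {a<..<b} \<longrightarrow> v y = w y"
  proof eventually_elim
    case (elim y)
    show ?case
    proof
      assume y: "y \<in> {a<..<b}"
      then obtain n where n: "inverse (real (Suc n)) < min (y - a) (b - y)"
        using reals_Archimedean[of "min (y - a) (b - y)"] by auto
      then have "y \<in> {a + 1 / (real n + 1)<..b - 1 / (real n + 1)}"
        by (auto simp: inverse_eq_divide add.commute)
      then show "v y = w y" using spec[OF elim, of n] by simp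
    qed
  qed
  then show ?thesis by (simp add: AE_restrict_space_iff)
qed

lemma weak_derivative_unique:
  fixes u :: "real \<Rightarrow> 'v::euclidean_space"
  assumes "has_weak_derivative a b u v" "has_weak_derivative a b u w" "continuous_on {a..b} u"
  shows "AE y in ivl a b. v y = w y"
  using assms weak_derivative_increment[OF assms(1,3)] weak_derivative_increment[OF assms(2,3)]
  by (intro AE_eq_of_interval_integrals) (auto simp: has_weak_derivative_def)

lemma has_weak_derivative_wderiv:
  "weakly_differentiable a b u \<Longrightarrow> has_weak_derivative a b u (wderiv a b u)"
  unfolding weakly_differentiable_def wderiv_def by (erule someI_ex)

lemma wderiv_AE:
  assumes "has_weak_derivative a b u v" "continuous_on {a..b} u"
  shows "AE y in ivl a b. v y = wderiv a b u y"
  using assms weak_derivative_unique has_weak_derivative_wderiv weakly_differentiable_def by blast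

lemma L2_locally_integrable:
  assumes "L2 (ivl a b) v"
  shows "locally_integrable a b v"
  unfolding locally_integrable_def
proof (intro allI impI)
  interpret finite_measure "ivl a b" by (rule finite_measure_ivl)
  fix s t assume "a < s \<and> t < b"
  moreover have "set_integrable lborel {a<..<b} v"
    using L2_integrable[OF assms] by (simp add: integrable_restrict_space set_integrable_def)
  ultimately show "set_integrable lborel {s..t} v"
    by (elim set_integrable_subset) auto
qed

text \<open>Borel measurability does not pass to an almost everywhere equal function, so it is
  obtained separately: local integrability makes the cut-offs to compact subintervals measurable,
  and these converge pointwise to the chosen version.\<close>

lemma wderiv_measurable_L2:
  fixes u :: "real \<Rightarrow> 'v::euclidean_space"
  assumes w: "has_weak_derivative a b u v" and u: "continuous_on {a..b} u" and v: "L2 (ivl a b) v"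
  shows "L2 (ivl a b) (wderiv a b u)"
proof -
  have m: "wderiv a b u \<in> borel_measurable (ivl a b)"
  proof -
    have li: "locally_integrable a b (wderiv a b u)"
      using has_weak_derivative_wderiv[of a b u] w
      by (auto simp: weakly_differentiable_def has_weak_derivative_def)
    define f where "f n y = indicator {a + 1 / (real n + 1)..b - 1 / (real n + 1)} y *\<^sub>R wderiv a b u y" for n y
    have "f n \<in> borel_measurable lborel" for n
      using li unfolding f_def locally_integrable_def set_integrable_def
      by (intro borel_measurable_integrable) (simp add: field_simps)
    then have fm: "f n \<in> borel_measurable (ivl a b)" for n by (intro measurable_ivl) simp
    show ?thesis
    proof (rule borel_measurable_LIMSEQ_metric[OF fm])
      fix y assume "y \<in> space (ivl a b)"
      then obtain N where N: "inverse (real (Suc N)) < min (y - a) (b - y)"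
        using reals_Archimedean[of "min (y - a) (b - y)"] by auto
      have "\<forall>\<^sub>F n in sequentially. f n y = wderiv a b u y"
        using eventually_ge_at_top[of N]
      proof eventually_elim
        case (elim n)
        have "1 / (real n + 1) \<le> inverse (real (Suc N))" using elim by (simp add: field_simps)
        with N show ?case by (auto simp: f_def indicator_def)
      qed
      then show "(\<lambda>n. f n y) \<longlonglongrightarrow> wderiv a b u y" by (rule tendsto_eventually)
    qed
  qed
  show ?thesis by (rule L2_cong_AE[OF v wderiv_AE[OF w u] m])
qed

text \<open>Inside (a,b) the functions u and \<open>prim a b v\<close> have equal increments, so
  their difference is constant there; continuity carries the constant to the closed interval, in
  particular to the end point \<open>a\<close>.\<close>

lemma weak_derivative_prim:
  fixes u :: "real \<Rightarrow> 'v::euclidean_space"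
  assumes w: "has_weak_derivative a b u v" and u: "continuous_on {a..b} u" and v: "L2 (ivl a b) v"
    and y: "y \<in> {a..b}" and ab: "a < b"
  shows "u y - u a = prim a b v y"
proof -
  define f where "f y = u y - prim a b v y" for y
  define m where "m = (a + b) / 2"
  have cl: "closure {a<..<b} = {a..b}" using ab by simp
  have cf: "continuous_on (closure {a<..<b}) f"
    unfolding f_def cl by (intro continuous_intros u continuous_on_prim v)
  have inc: "f t = f s" if "a < s" "s \<le> t" "t < b" for s t
  proof -
    have "(LINT y|ivl a b. indicator {s<..t} y *\<^sub>R v y)
        = (LINT y|lborel. indicator {a<..<b} y *\<^sub>R (indicator {s<..t} y *\<^sub>R v y))"
      by (simp add: integral_restrict_space)
    also have "\<dots> = (LINT y|lborel. indicator {s<..t} y *\<^sub>R v y)"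
      using that by (intro Bochner_Integration.integral_cong) (auto simp: indicator_def)
    finally have "prim a b v t - prim a b v s = u t - u s"
      using prim_diff[OF v that(2)] weak_derivative_increment[OF w u that] by simp
    then show ?thesis by (simp add: f_def algebra_simps)
  qed
  have "f z = f m" if "z \<in> {a<..<b}" for z
    using inc[of m z] inc[of z m] that by (cases "m \<le> z") (auto simp: m_def)
  then have "f z = f m" if "z \<in> closure {a<..<b}" for z
    using continuous_constant_on_closure[OF cf _ that, of "f m"] by blast
  from this[of y] this[of a] have "f y = f a" using y ab by (simp add: cl)
  then show ?thesis by (simp add: f_def prim_le_a algebra_simps)
qed

section \<open>Closedness and midpoint linearity of the weak derivative\<close>

lemma test_function_continuous:
  assumes "test_function a b \<phi>"
  shows "continuous_on A \<phi>" "continuous_on A (deriv \<phi>)"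
proof -
  obtain D where D: "\<And>x. (\<phi> has_vector_derivative D x) (at x)" "continuous_on UNIV D"
    using assms by (auto simp: test_function_def C1_differentiable_on_def)
  then have d: "(\<phi> has_real_derivative D x) (at x)" for x
    by (simp add: has_real_derivative_iff_has_vector_derivative)
  show "continuous_on A \<phi>" using d by (intro continuous_at_imp_continuous_on ballI DERIV_isCont) auto
  have "deriv \<phi> = D" using DERIV_imp_deriv[OF d] by auto
  then show "continuous_on A (deriv \<phi>)" using D(2) continuous_on_subset by blast
qed

lemma integral_test_L2:
  fixes v :: "real \<Rightarrow> 'v::euclidean_space"
  assumes \<phi>: "continuous_on UNIV \<phi>" and v: "L2 (ivl a b) v"
  shows "integrable (ivl a b) (\<lambda>y. \<phi> y *\<^sub>R v y)"
    and "(norm (LINT y|ivl a b. \<phi> y *\<^sub>R v y))\<^sup>2 \<le> nsq (ivl a b) \<phi> * nsq (ivl a b) v"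
proof -
  have "L2 (ivl a b) \<phi>" by (rule L2_continuous_on) (rule continuous_on_subset[OF \<phi>], simp)
  then show "integrable (ivl a b) (\<lambda>y. \<phi> y *\<^sub>R v y)"
    "(norm (LINT y|ivl a b. \<phi> y *\<^sub>R v y))\<^sup>2 \<le> nsq (ivl a b) \<phi> * nsq (ivl a b) v"
    using L2_integral_weighted[OF v, of \<phi>] by (simp_all add: L2_def nsq_def)
qed

lemma tendsto_integral_test:
  fixes v :: "real \<Rightarrow> 'v::euclidean_space"
  assumes \<phi>: "continuous_on UNIV \<phi>" and v: "L2 (ivl a b) v" and X: "\<And>n. L2 (ivl a b) (X n)"
    and lim: "(\<lambda>n. nsq (ivl a b) (\<lambda>y. X n y - v y)) \<longlonglongrightarrow> 0"
  shows "(\<lambda>n. LINT y|ivl a b. \<phi> y *\<^sub>R X n y) \<longlonglongrightarrow> (LINT y|ivl a b. \<phi> y *\<^sub>R v y)"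
proof -
  let ?e = "\<lambda>n. nsq (ivl a b) \<phi> * nsq (ivl a b) (\<lambda>y. X n y - v y)"
  have le: "norm ((LINT y|ivl a b. \<phi> y *\<^sub>R X n y) - (LINT y|ivl a b. \<phi> y *\<^sub>R v y)) \<le> sqrt (?e n)" for n
  proof (rule real_le_rsqrt)
    have "(LINT y|ivl a b. \<phi> y *\<^sub>R X n y) - (LINT y|ivl a b. \<phi> y *\<^sub>R v y)
        = (LINT y|ivl a b. \<phi> y *\<^sub>R (X n y - v y))"
      unfolding scaleR_diff_right
      by (rule Bochner_Integration.integral_diff[symmetric]) (rule integral_test_L2(1)[OF \<phi>] X v)+
    then show "(norm ((LINT y|ivl a b. \<phi> y *\<^sub>R X n y) - (LINT y|ivl a b. \<phi> y *\<^sub>R v y)))\<^sup>2 \<le> ?e n"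
      using integral_test_L2(2)[OF \<phi> L2_diff[OF X v]] by simp
  qed
  have "(\<lambda>n. sqrt (?e n)) \<longlonglongrightarrow> sqrt (nsq (ivl a b) \<phi> * 0)"
    by (intro tendsto_intros lim)
  then have e: "(\<lambda>n. sqrt (?e n)) \<longlonglongrightarrow> 0" by simp
  have "(\<lambda>n. (LINT y|ivl a b. \<phi> y *\<^sub>R X n y) - (LINT y|ivl a b. \<phi> y *\<^sub>R v y)) \<longlonglongrightarrow> 0"
    by (rule Lim_null_comparison[OF always_eventually e]) (rule allI le)+
  then show ?thesis by (simp add: LIM_zero_iff)
qed

text \<open>
  Weak differentiability of the primitives that arise as limits of minimizing sequences comes from
  this closedness property, so that no integration by parts for primitives is required.
\<close>

lemma has_weak_derivative_limit:
  fixes u v :: "real \<Rightarrow> 'v::euclidean_space"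
  assumes w: "\<And>n. has_weak_derivative a b (U n) (V n)"
    and U: "\<And>n. L2 (ivl a b) (U n)" and V: "\<And>n. L2 (ivl a b) (V n)"
    and u: "L2 (ivl a b) u" and v: "L2 (ivl a b) v"
    and lu: "(\<lambda>n. nsq (ivl a b) (\<lambda>y. U n y - u y)) \<longlonglongrightarrow> 0"
    and lv: "(\<lambda>n. nsq (ivl a b) (\<lambda>y. V n y - v y)) \<longlonglongrightarrow> 0"
  shows "has_weak_derivative a b u v"
  unfolding has_weak_derivative_def set_LINT_ivl
proof (intro conjI allI impI L2_locally_integrable u v)
  fix \<phi> assume t: "test_function a b \<phi>"
  have "(\<lambda>n. LINT y|ivl a b. deriv \<phi> y *\<^sub>R U n y) \<longlonglongrightarrow> (LINT y|ivl a b. deriv \<phi> y *\<^sub>R u y)"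
    by (intro tendsto_integral_test test_function_continuous[OF t] U u lu)
  moreover have "(\<lambda>n. - (LINT y|ivl a b. \<phi> y *\<^sub>R V n y)) \<longlonglongrightarrow> - (LINT y|ivl a b. \<phi> y *\<^sub>R v y)"
    by (intro tendsto_minus tendsto_integral_test test_function_continuous[OF t] V v lv)
  moreover have "(LINT y|ivl a b. deriv \<phi> y *\<^sub>R U n y) = - (LINT y|ivl a b. \<phi> y *\<^sub>R V n y)" for n
    using w t by (auto simp: has_weak_derivative_def set_LINT_ivl)
  ultimately show "(LINT y|ivl a b. deriv \<phi> y *\<^sub>R u y) = - (LINT y|ivl a b. \<phi> y *\<^sub>R v y)"
    by (simp add: LIMSEQ_unique)
qed

text \<open>Midpoints are the combinations at which the parallelogram law evaluates the
  functional.\<close>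

lemma has_weak_derivative_mid:
  fixes u v :: "real \<Rightarrow> 'v::euclidean_space"
  assumes w: "has_weak_derivative a b u v" "has_weak_derivative a b u' v'"
    and L: "L2 (ivl a b) u" "L2 (ivl a b) u'" "L2 (ivl a b) v" "L2 (ivl a b) v'"
  shows "has_weak_derivative a b (\<lambda>y. (1/2) *\<^sub>R (u y + u' y)) (\<lambda>y. (1/2) *\<^sub>R (v y + v' y))"
  unfolding has_weak_derivative_def set_LINT_ivl
proof (intro conjI allI impI L2_locally_integrable L2_scaleR L2_add L)
  fix \<phi> assume t: "test_function a b \<phi>"
  have e: "(LINT y|ivl a b. \<psi> y *\<^sub>R ((1/2) *\<^sub>R (p y + q y)))
      = (1/2) *\<^sub>R ((LINT y|ivl a b. \<psi> y *\<^sub>R p y) + (LINT y|ivl a b. \<psi> y *\<^sub>R q y))"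
    if "continuous_on UNIV \<psi>" "L2 (ivl a b) p" "L2 (ivl a b) q" for \<psi> and p q :: "real \<Rightarrow> 'v"
  proof -
    have "(LINT y|ivl a b. \<psi> y *\<^sub>R ((1/2) *\<^sub>R (p y + q y)))
        = (LINT y|ivl a b. (1/2) *\<^sub>R (\<psi> y *\<^sub>R p y + \<psi> y *\<^sub>R q y))"
      by (intro Bochner_Integration.integral_cong) (auto simp: algebra_simps)
    also have "\<dots> = (1/2) *\<^sub>R ((LINT y|ivl a b. \<psi> y *\<^sub>R p y) + (LINT y|ivl a b. \<psi> y *\<^sub>R q y))"
      unfolding integral_scaleR_right
      by (subst Bochner_Integration.integral_add[OF integral_test_L2(1)[OF that(1,2)] integral_test_L2(1)[OF that(1,3)]]) (rule refl)
    finally show ?thesis .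
  qed
  show "(LINT y|ivl a b. deriv \<phi> y *\<^sub>R ((1/2) *\<^sub>R (u y + u' y)))
      = - (LINT y|ivl a b. \<phi> y *\<^sub>R ((1/2) *\<^sub>R (v y + v' y)))"
    using w t unfolding e[OF test_function_continuous(2)[OF t] L(1,2)]
      e[OF test_function_continuous(1)[OF t] L(3,4)]
    by (auto simp: has_weak_derivative_def set_LINT_ivl algebra_simps)
qed

section \<open>Continuity of the coefficient matrices\<close>

text \<open>Strong induction along Gram-Schmidt: each function is a combination of
  \<open>phi n\<close> and earlier ones, divided by a constant. A vanishing constant is covered as
  well, since the quotient is then 0.\<close>

lemma Psi_C1:
  "\<exists>f'. continuous_on UNIV f' \<and> (\<forall>x. (Psi d n has_real_derivative f' x) (at x))"
proof (induct n rule: less_induct)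
  case (less n)
  define g where "g k = (SOME f'. continuous_on UNIV f' \<and> (\<forall>x. (Psi d k has_real_derivative f' x) (at x)))" for k
  have g: "continuous_on UNIV (g k)" "(Psi d k has_real_derivative g k x) (at x)" if "k < n" for k x
    using someI_ex[OF less[OF that]] by (auto simp: g_def)
  define p where "p x = real (n - 1) * x ^ (n - 1 - 1) * exp x + x ^ (n - 1) * exp x" for x :: real
  have p: "(phi n has_real_derivative p x) (at x)" for x
    unfolding phi_def p_def by (auto intro!: derivative_eq_intros)
  define u where "u = (\<lambda>\<alpha>. phi n \<alpha> - (\<Sum>k\<in>{1..<n}. l2_inner d (phi n) (Psi d k) * Psi d k \<alpha>))"
  define c where "c = sqrt (l2_inner d u u)"
  have P: "Psi d n = (\<lambda>\<alpha>. u \<alpha> / c)"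
    unfolding Psi.simps[of d n] Let_def u_def c_def ..
  let ?q = "\<lambda>x. (p x - (\<Sum>k\<in>{1..<n}. l2_inner d (phi n) (Psi d k) * g k x)) / c"
  have "continuous_on UNIV p" unfolding p_def by (intro continuous_intros)
  then have "continuous_on UNIV ?q" unfolding divide_inverse
    by (intro continuous_intros g) auto
  moreover have "(Psi d n has_real_derivative ?q x) (at x)" for x
    unfolding P u_def by (intro DERIV_cdivide DERIV_diff p DERIV_sum DERIV_cmult g) auto
  ultimately show ?case by blast
qed

lemma continuous_on_Psi: "continuous_on A (Psi d n)"
  using Psi_C1[of d n] by (meson continuous_at_imp_continuous_on DERIV_isCont)

lemma continuous_on_deriv_Psi: "continuous_on A (deriv (Psi d n))"
proof -
  obtain f' where f': "continuous_on UNIV f'" "\<And>x. (Psi d n has_real_derivative f' x) (at x)"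
    using Psi_C1 by blast
  have "deriv (Psi d n) = f'" using DERIV_imp_deriv[OF f'(2)] by auto
  then show ?thesis using f'(1) continuous_on_subset by blast
qed

lemma continuous_on_Psi_compose [continuous_intros]:
  "continuous_on A f \<Longrightarrow> continuous_on A (\<lambda>x. Psi d n (f x))"
  "continuous_on A f \<Longrightarrow> continuous_on A (\<lambda>x. deriv (Psi d n) (f x))"
  by (auto intro: continuous_on_compose2[OF continuous_on_Psi[of UNIV]]
      continuous_on_compose2[OF continuous_on_deriv_Psi[of UNIV]])

text \<open>For y > 0 the denominator is positive even at \<alpha> = x, so this is continuity of a
  parameter integral with a jointly continuous integrand.\<close>

lemma continuous_on_D1_mat: "continuous_on {0<..} (D1_mat d x :: real \<Rightarrow> real^'n::{finite,linorder}^'n::{finite,linorder})"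
proof -
  have "continuous_on {0<..} (\<lambda>y. integral (cbox (-d) d)
      (\<lambda>\<alpha>. (x - \<alpha>) / ((x - \<alpha>)\<^sup>2 + y\<^sup>2) * Psi d m \<alpha> * Psi d n \<alpha>))" for m n
    by (rule integral_continuous_on_param)
      (auto simp: case_prod_unfold sum_power2_eq_zero_iff intro!: continuous_intros)
  then show ?thesis unfolding D1_mat_def by (auto intro!: continuous_intros)
qed

lemma continuous_on_D2_mat: "continuous_on {0<..} (D2_mat d x :: real \<Rightarrow> real^'n::{finite,linorder}^'n::{finite,linorder})"
proof -
  have "continuous_on {0<..} (\<lambda>y. integral (cbox (-d) d)
      (\<lambda>\<alpha>. - ((x - \<alpha>) / y) * Psi d m \<alpha> * deriv (Psi d n) \<alpha>
        + y / ((x - \<alpha>)\<^sup>2 + y\<^sup>2) * Psi d m \<alpha> * Psi d n \<alpha>))" for m n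
    by (rule integral_continuous_on_param)
      (auto simp: case_prod_unfold sum_power2_eq_zero_iff intro!: continuous_intros)
  then show ?thesis unfolding D2_mat_def by (auto intro!: continuous_intros)
qed

section \<open>Continuity of products, determinants and inverses of matrices\<close>

lemma continuous_on_matrix_mult:
  fixes A :: "'a::topological_space \<Rightarrow> real^'n^'m" and B :: "'a \<Rightarrow> real^'k^'n"
  assumes "continuous_on S A" "continuous_on S B"
  shows "continuous_on S (\<lambda>x. A x ** B x)"
  unfolding matrix_matrix_mult_def by (intro continuous_intros assms)

lemma continuous_on_det:
  fixes A :: "'a::topological_space \<Rightarrow> real^'n^'n"
  assumes "continuous_on S A"
  shows "continuous_on S (\<lambda>x. det (A x))"
  unfolding det_def by (intro continuous_intros assms)

text \<open>Cramer's rule applied to the basis vector \<open>axis l 1\<close>: a quotient of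
  determinants makes continuity of the inverse visible.\<close>

lemma matrix_inv_entry:
  fixes A :: "real^'n^'n"
  assumes "invertible A"
  shows "matrix_inv A $ k $ l = det (\<chi> i j. if j = k then axis l 1 $ i else A $ i $ j) / det A"
proof -
  have "A ** matrix_inv A = mat 1 \<and> matrix_inv A ** A = mat 1"
    using assms unfolding invertible_def matrix_inv_def by (rule someI_ex)
  then have "A *v (matrix_inv A *v axis l 1) = axis l 1" by (simp add: matrix_vector_mul_assoc)
  then have "matrix_inv A *v axis l 1
      = (\<chi> k. det (\<chi> i j. if j = k then axis l 1 $ i else A $ i $ j) / det A)"
    using cramer[of A] assms by (simp add: invertible_det_nz)
  then show ?thesis by (simp add: matrix_vector_mult_basis column_def vec_eq_iff)
qed

lemma continuous_on_matrix_inv: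
  fixes A :: "'a::topological_space \<Rightarrow> real^'n^'n"
  assumes A: "continuous_on S A" and inv: "\<And>x. x \<in> S \<Longrightarrow> invertible (A x)"
  shows "continuous_on S (\<lambda>x. matrix_inv (A x))"
proof -
  have "continuous_on S (\<lambda>x. \<chi> k l. det (\<chi> i j. if j = k then axis l 1 $ i else A x $ i $ j) / det (A x))"
  proof (intro continuous_intros continuous_on_det A)
    show "continuous_on S (\<lambda>x. if j = k then axis l 1 $ i else A x $ i $ j)" for i j k l
      by (cases "j = k") (auto intro!: continuous_intros A)
    show "\<forall>x\<in>S. det (A x) \<noteq> 0" using inv by (simp add: invertible_det_nz)
  qed
  then show ?thesis
    by (rule continuous_on_eq) (simp add: vec_eq_iff matrix_inv_entry inv)
qed

text \<open>Serves the measurability of D^h U_x; its size is controlled by C1 instead.\<close>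

lemma continuous_on_D_mat:
  assumes "0 < a" and inv: "\<And>y. y \<in> {a..b} \<Longrightarrow> invertible (lead_mat d x y :: real^'n::{finite,linorder}^'n::{finite,linorder})"
  shows "continuous_on {a..b} (D_mat d x :: real \<Rightarrow> real^'n::{finite,linorder}^'n::{finite,linorder})"
proof -
  have sub: "{a..b} \<subseteq> {0<..}" using assms by auto
  have "continuous_on {a..b} (lead_mat d x :: real \<Rightarrow> real^'n::{finite,linorder}^'n::{finite,linorder})"
    unfolding lead_mat_def
    by (intro continuous_on_matrix_mult continuous_intros continuous_on_subset[OF continuous_on_D1_mat sub])
  then show ?thesis unfolding D_mat_def
    by (intro continuous_on_minus continuous_on_matrix_mult continuous_on_matrix_inv inv
        continuous_on_subset[OF continuous_on_D2_mat sub])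
qed

text \<open>The norm is the Frobenius norm, so Cauchy-Schwarz in each row suffices.\<close>

lemma norm_matrix_vector_le:
  fixes A :: "real^'n^'m" and x :: "real^'n"
  shows "norm (A *v x) \<le> norm A * norm x"
proof -
  have "(norm (A *v x))\<^sup>2 = (\<Sum>i\<in>UNIV. (A $ i \<bullet> x)\<^sup>2)"
    by (simp add: norm_vec_def L2_set_def sum_nonneg matrix_mult_dot)
  also have "\<dots> \<le> (\<Sum>i\<in>UNIV. (norm (A $ i))\<^sup>2 * (norm x)\<^sup>2)"
    by (intro sum_mono) (metis Cauchy_Schwarz_ineq power2_norm_eq_inner)
  also have "\<dots> = (norm A * norm x)\<^sup>2"
    by (simp add: norm_vec_def[of A] L2_set_def sum_nonneg power_mult_distrib sum_distrib_right)
  finally show ?thesis by (rule power2_le_imp_le) simp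
qed

lemma norm_matrix_vector_sq_le:
  fixes A :: "real^'n^'m" and x :: "real^'n"
  assumes "norm A \<le> c"
  shows "(norm (A *v x))\<^sup>2 \<le> c\<^sup>2 * (norm x)\<^sup>2"
proof -
  have "norm (A *v x) \<le> c * norm x"
    using norm_matrix_vector_le[of A x] assms by (meson mult_right_mono norm_ge_zero order_trans)
  then show ?thesis by (metis norm_ge_zero power_mono power_mult_distrib)
qed

section \<open>Minimization and the Carleman estimate\<close>

text \<open>The direct method with \<open>dst\<close> in the role of a squared distance.
  \<open>mid\<close> is uniform convexity and makes a minimizing sequence Cauchy; \<open>lsc\<close>
  is used with n tending to infinity first and \<eta> tending to 0 afterwards, which removes the
  factor 1 + \<eta>.\<close>

lemma quadratic_minimizer_exists:
  fixes J :: "'a \<Rightarrow> real" and dst :: "'a \<Rightarrow> 'a \<Rightarrow> real"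
  assumes ne: "S \<noteq> {}" and pos: "\<And>u. u \<in> S \<Longrightarrow> 0 \<le> J u" and c: "0 < c"
    and mid: "\<And>u v. u \<in> S \<Longrightarrow> v \<in> S \<Longrightarrow> \<exists>m\<in>S. c * dst u v \<le> J u + J v - 2 * J m"
    and complete: "\<And>X. (\<And>n. X n \<in> S) \<Longrightarrow>
      (\<And>e. e > 0 \<Longrightarrow> \<exists>N. \<forall>m\<ge>N. \<forall>n\<ge>N. dst (X m) (X n) < e) \<Longrightarrow>
      \<exists>u\<in>S. (\<lambda>n::nat. dst (X n) u) \<longlonglongrightarrow> 0"
    and lsc: "\<And>u v \<eta>. u \<in> S \<Longrightarrow> v \<in> S \<Longrightarrow> 0 < \<eta> \<Longrightarrow>
      J u \<le> (1 + \<eta>) * J v + (1 + 1 / \<eta>) * (B * dst v u)"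
  shows "\<exists>u\<in>S. \<forall>v\<in>S. J u \<le> J v"
proof -
  define l where "l = (INF u\<in>S. J u)"
  have bdd: "bdd_below (J ` S)" using pos by (intro bdd_belowI[of _ 0]) auto
  have l: "l \<le> J u" if "u \<in> S" for u unfolding l_def by (rule cINF_lower[OF bdd that])
  have "\<exists>u\<in>S. J u < l + 1 / (real n + 1)" for n
    using cINF_less_iff[OF ne bdd, of "l + 1 / (real n + 1)"] by (simp add: l_def)
  then obtain X where X: "\<And>n. X n \<in> S" "\<And>n. J (X n) < l + 1 / (real n + 1)" by metis
  have Cau: "\<exists>N. \<forall>m\<ge>N. \<forall>n\<ge>N. dst (X m) (X n) < e" if e: "e > 0" for e
  proof -
    \<comment> \<open>Two excesses over the infimum, each below c e / 2, bound c times the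
      distance.\<close>
    obtain N where N: "inverse (real (Suc N)) < c * e / 2"
      using reals_Archimedean[of "c * e / 2"] c e by (meson half_gt_zero mult_pos_pos)
    have "dst (X m) (X n) < e" if mn: "m \<ge> N" "n \<ge> N" for m n
    proof -
      have k: "1 / (real k + 1) < c * e / 2" if "k \<ge> N" for k
      proof -
        have "1 / (real k + 1) \<le> inverse (real (Suc N))" using that by (simp add: field_simps)
        then show ?thesis using N by simp
      qed
      obtain z where z: "z \<in> S" "c * dst (X m) (X n) \<le> J (X m) + J (X n) - 2 * J z"
        using mid[OF X(1) X(1)] by blast
      have "c * dst (X m) (X n) < c * e"
        using z(2) l[OF z(1)] X(2)[of m] X(2)[of n] k[OF mn(1)] k[OF mn(2)] by linarith
      then show ?thesis using c by simp
    qed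
    then show ?thesis by blast
  qed
  obtain u where u: "u \<in> S" "(\<lambda>n. dst (X n) u) \<longlonglongrightarrow> 0" using complete[OF X(1) Cau] by blast
  have le: "J u \<le> (1 + \<eta>) * l" if "\<eta> > 0" for \<eta>
  proof (rule LIMSEQ_le_const)
    have "(\<lambda>n. (1 + \<eta>) * (l + 1 / (real n + 1)) + (1 + 1 / \<eta>) * (B * dst (X n) u))
        \<longlonglongrightarrow> (1 + \<eta>) * (l + 0) + (1 + 1 / \<eta>) * (B * 0)"
      by (intro tendsto_intros tendsto_scale_seq u)
    then show "(\<lambda>n. (1 + \<eta>) * (l + 1 / (real n + 1)) + (1 + 1 / \<eta>) * (B * dst (X n) u)) \<longlonglongrightarrow> (1 + \<eta>) * l"
      by simp
    have "J u \<le> (1 + \<eta>) * (l + 1 / (real n + 1)) + (1 + 1 / \<eta>) * (B * dst (X n) u)" for n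
    proof -
      have "(1 + \<eta>) * J (X n) \<le> (1 + \<eta>) * (l + 1 / (real n + 1))"
        using X(2)[of n] that by (intro mult_left_mono) auto
      then show ?thesis using lsc[OF u(1) X(1)[of n] that] by linarith
    qed
    then show "\<exists>N. \<forall>n\<ge>N. J u \<le> (1 + \<eta>) * (l + 1 / (real n + 1)) + (1 + 1 / \<eta>) * (B * dst (X n) u)" by blast
  qed
  have "l \<ge> 0" unfolding l_def using ne pos by (intro cINF_greatest) auto
  have "J u \<le> l"
  proof (rule field_le_epsilon)
    fix e :: real assume "e > 0"
    \<comment> \<open>With \<eta> = e / (l + 1) the surplus \<eta> l is at most e, also when l =
      0.\<close>
    have "J u \<le> (1 + e / (l + 1)) * l" using \<open>e > 0\<close> \<open>l \<ge> 0\<close> by (intro le) simp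
    also have "\<dots> \<le> l + e" using \<open>e > 0\<close> \<open>l \<ge> 0\<close> by (simp add: field_simps)
    finally show "J u \<le> l + e" .
  qed
  then show ?thesis using u(1) l by (meson order_trans)
qed

section \<open>The weighted coercivity estimate\<close>

lemma nsq_le_const:
  assumes "L2 (ivl a b) f" "a \<le> b" "\<And>y. y \<in> {a<..<b} \<Longrightarrow> (norm (f y))\<^sup>2 \<le> c"
  shows "nsq (ivl a b) f \<le> (b - a) * c"
proof -
  interpret finite_measure "ivl a b" by (rule finite_measure_ivl)
  have "nsq (ivl a b) f \<le> (LINT y|ivl a b. c)"
    unfolding nsq_def using assms(1,3) by (intro integral_mono) (auto simp: L2_def)
  then show ?thesis using assms(2) by (simp add: measure_ivl)
qed

lemma nsq_mono:
  assumes "L2 M f" "L2 M g" "0 \<le> c" "\<And>x. x \<in> space M \<Longrightarrow> (norm (f x))\<^sup>2 \<le> c * (norm (g x))\<^sup>2"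
  shows "nsq M f \<le> c * nsq M g"
proof -
  have "nsq M f \<le> (LINT x|M. c * (norm (g x))\<^sup>2)"
    unfolding nsq_def using assms by (intro integral_mono) (auto simp: L2_def)
  then show ?thesis by (simp add: nsq_def)
qed

text \<open>Here h >= \<open>h0\<close> turns the difference quotient into a bounded operator. The
  zero boundary components matter at the first and last interior index, whose neighbours lie outside
  the sum.\<close>

lemma norm_diff_x_sq_le:
  fixes W :: "nat \<Rightarrow> real \<Rightarrow> 'v::euclidean_space"
  assumes "0 < h0" "h0 \<le> h" "j \<in> {1..<K}" "W 0 y = 0" "W K y = 0"
  shows "(norm (diff_x h W j y))\<^sup>2 \<le> (\<Sum>i\<in>{1..<K}. (norm (W i y))\<^sup>2) / h0\<^sup>2"
proof -
  let ?w = "\<Sum>i\<in>{1..<K}. (norm (W i y))\<^sup>2"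
  have w: "(norm (W i y))\<^sup>2 \<le> ?w" if "i \<le> K" for i
  proof (cases "i = 0 \<or> i = K")
    case True
    then show ?thesis using assms(4,5) by (auto intro!: sum_nonneg)
  next
    case False
    then show ?thesis using that by (intro member_le_sum) auto
  qed
  have "norm (diff_x h W j y) = norm (W (j + 1) y - W (j - 1) y) / (2 * h)"
    using assms(1,2) unfolding diff_x_def norm_scaleR by (simp add: divide_simps)
  then have "(norm (diff_x h W j y))\<^sup>2 = (norm (W (j + 1) y - W (j - 1) y))\<^sup>2 / (4 * h\<^sup>2)"
    by (simp only: power_divide power_mult_distrib) simp
  also have "\<dots> \<le> (4 * ?w) / (4 * h\<^sup>2)"
  proof (rule divide_right_mono)
    have "j + 1 \<le> K" "j - 1 \<le> K" using assms(3) by auto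
    then show "(norm (W (j + 1) y - W (j - 1) y))\<^sup>2 \<le> 4 * ?w"
      using norm_diff_sq_le[of "W (j + 1) y" "W (j - 1) y"] w[of "j + 1"] w[of "j - 1"] by linarith
  qed simp
  also have "\<dots> = ?w / h\<^sup>2" by simp
  also have "\<dots> \<le> ?w / h0\<^sup>2"
    using assms(1,2) by (intro divide_left_mono power_mono sum_nonneg) auto
  finally show ?thesis .
qed

text \<open>The tuple \<open>v\<close> plays the derivative of W and \<open>r\<close> the residual.
  In the weighted norm the term A W_x is small relative to v for large \<kappa>, hence can be
  absorbed; removing the weight afterwards produces the exponential.\<close>

lemma Carleman_estimate:
  fixes v r :: "nat \<Rightarrow> real \<Rightarrow> real^'n" and W :: "nat \<Rightarrow> real \<Rightarrow> real^'n"
    and A :: "nat \<Rightarrow> real \<Rightarrow> real^'n^'n"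
  assumes ab: "a < b" and h: "0 < h0" "h0 \<le> h" and k: "real K \<le> k"
    and v: "\<And>j. j \<in> {1..<K} \<Longrightarrow> L2 (ivl a b) (v j)" and r: "\<And>j. j \<in> {1..<K} \<Longrightarrow> L2 (ivl a b) (r j)"
    and eq: "\<And>j y. j \<in> {1..<K} \<Longrightarrow> y \<in> {a<..<b} \<Longrightarrow> r j y = v j y + A j y *v diff_x h W j y"
    and W: "\<And>j y. j \<in> {1..<K} \<Longrightarrow> y \<in> {a<..<b} \<Longrightarrow> W j y = prim a b (v j) y"
    and W0: "\<And>y. y \<in> {a<..<b} \<Longrightarrow> W 0 y = 0" and WK: "\<And>y. y \<in> {a<..<b} \<Longrightarrow> W K y = 0"
    and A: "\<And>j y. j \<in> {1..<K} \<Longrightarrow> y \<in> {a<..<b} \<Longrightarrow> norm (A j y) \<le> C1"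
  shows "(\<Sum>j\<in>{1..<K}. nsq (ivl a b) (v j))
    \<le> 4 * exp ((4 * k * C1\<^sup>2 * (b - a) / h0\<^sup>2 + 1) * (b - a)) * (\<Sum>j\<in>{1..<K}. nsq (ivl a b) (r j))"
proof -
  let ?I = "{1..<K}" and ?M = "ivl a b"
  \<comment> \<open>Chosen so that the summed zero-order terms are at most (2 q / \<kappa>) S. With
    \<kappa> = 4 q + 1 this is at most S / 2, and \<kappa> stays positive when q = 0.\<close>
  define q where "q = k * C1\<^sup>2 * (b - a) / h0\<^sup>2"
  define \<kappa> where "\<kappa> = 4 * q + 1"
  have k0: "0 \<le> k" using k of_nat_0_le_iff[of K] by linarith
  have q: "0 \<le> q" using k0 ab by (simp add: q_def)
  then have \<kappa>: "\<kappa> > 0" by (simp add: \<kappa>_def)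
  let ?e = "\<lambda>y. exp (- \<kappa> / 2 * y)"
  have sqe: "(?e y)\<^sup>2 = exp (- \<kappa> * y)" for y
    by (simp add: power2_eq_square flip: exp_add)
  define S where "S = (\<Sum>j\<in>?I. nsq ?M (\<lambda>y. ?e y *\<^sub>R v j y))"
  define T where "T = (\<Sum>j\<in>?I. nsq ?M (\<lambda>y. ?e y *\<^sub>R r j y))"
  have S0: "0 \<le> S" unfolding S_def by (intro sum_nonneg) simp
  have each: "nsq ?M (\<lambda>y. ?e y *\<^sub>R v j y)
      \<le> 2 * nsq ?M (\<lambda>y. ?e y *\<^sub>R r j y) + 2 * ((b - a) * (C1\<^sup>2 / h0\<^sup>2 * (S / \<kappa>)))" if j: "j \<in> ?I" for j
  proof -
    note Lr = L2_exp_weight[OF r[OF j], of "- \<kappa> / 2"] and Lv = L2_exp_weight[OF v[OF j], of "- \<kappa> / 2"]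
    \<comment> \<open>The weighted zero-order term A W_x. At each y it is bounded by the weighted
      norms of all components of v, because every interior W i is a primitive.\<close>
    let ?d = "\<lambda>y. ?e y *\<^sub>R r j y - ?e y *\<^sub>R v j y"
    have Ld: "L2 ?M ?d" by (rule L2_diff[OF Lr Lv])
    have "nsq ?M (\<lambda>y. ?e y *\<^sub>R v j y) = nsq ?M (\<lambda>y. ?e y *\<^sub>R r j y - ?d y)" by simp
    also have "\<dots> \<le> 2 * nsq ?M (\<lambda>y. ?e y *\<^sub>R r j y) + 2 * nsq ?M ?d" by (rule nsq_diff_le[OF Lr Ld])
    also have "nsq ?M ?d \<le> (b - a) * (C1\<^sup>2 / h0\<^sup>2 * (S / \<kappa>))"
    proof (rule nsq_le_const[OF Ld])
      show "a \<le> b" using ab by simp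
      fix y assume y: "y \<in> {a<..<b}"
      have "?d y = ?e y *\<^sub>R (A j y *v diff_x h W j y)" by (simp add: eq[OF j y] flip: scaleR_diff_right)
      then have "(norm (?d y))\<^sup>2 = exp (- \<kappa> * y) * (norm (A j y *v diff_x h W j y))\<^sup>2"
        by (simp only: norm_scaleR power_mult_distrib power2_abs real_norm_def sqe)
      also have "\<dots> \<le> exp (- \<kappa> * y) * (C1\<^sup>2 * ((\<Sum>i\<in>?I. (norm (W i y))\<^sup>2) / h0\<^sup>2))"
      proof (intro mult_left_mono)
        have "(norm (A j y *v diff_x h W j y))\<^sup>2 \<le> C1\<^sup>2 * (norm (diff_x h W j y))\<^sup>2"
          by (rule norm_matrix_vector_sq_le[OF A[OF j y]])
        also have "\<dots> \<le> C1\<^sup>2 * ((\<Sum>i\<in>?I. (norm (W i y))\<^sup>2) / h0\<^sup>2)"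
          using h j y W0 WK by (intro mult_left_mono norm_diff_x_sq_le) auto
        finally show "(norm (A j y *v diff_x h W j y))\<^sup>2 \<le> C1\<^sup>2 * ((\<Sum>i\<in>?I. (norm (W i y))\<^sup>2) / h0\<^sup>2)" .
      qed simp
      also have "\<dots> = C1\<^sup>2 / h0\<^sup>2 * (\<Sum>i\<in>?I. exp (- \<kappa> * y) * (norm (W i y))\<^sup>2)"
        by (simp add: sum_distrib_left[symmetric] mult_ac)
      also have "\<dots> \<le> C1\<^sup>2 / h0\<^sup>2 * (\<Sum>i\<in>?I. nsq ?M (\<lambda>y. ?e y *\<^sub>R v i y) / \<kappa>)"
        using prim_weighted_bound[OF v \<kappa>] W y by (intro mult_left_mono sum_mono) auto
      also have "\<dots> = C1\<^sup>2 / h0\<^sup>2 * (S / \<kappa>)" by (simp add: S_def sum_divide_distrib)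
      finally show "(norm (?d y))\<^sup>2 \<le> C1\<^sup>2 / h0\<^sup>2 * (S / \<kappa>)" .
    qed
    finally show ?thesis by simp
  qed
  have "S \<le> (\<Sum>j\<in>?I. 2 * nsq ?M (\<lambda>y. ?e y *\<^sub>R r j y) + 2 * ((b - a) * (C1\<^sup>2 / h0\<^sup>2 * (S / \<kappa>))))"
    unfolding S_def using each by (intro sum_mono) (simp add: S_def)
  also have "\<dots> = 2 * T + real (K - 1) * (2 * ((b - a) * (C1\<^sup>2 / h0\<^sup>2 * (S / \<kappa>))))"
    by (simp add: sum.distrib T_def sum_distrib_left)
  \<comment> \<open>The zero-order bound is the same for all K - 1 indices, and k dominates their
    number.\<close>
  also have "\<dots> \<le> 2 * T + k * (2 * ((b - a) * (C1\<^sup>2 / h0\<^sup>2 * (S / \<kappa>))))"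
    using k k0 S0 \<kappa> ab by (intro add_left_mono mult_right_mono) auto
  also have "k * (2 * ((b - a) * (C1\<^sup>2 / h0\<^sup>2 * (S / \<kappa>)))) = (2 * q / \<kappa>) * S" by (simp add: q_def)
  also have "(2 * q / \<kappa>) * S \<le> (1 / 2) * S"
    using q S0 \<kappa> by (intro mult_right_mono) (auto simp: \<kappa>_def field_simps)
  finally have ST: "S \<le> 4 * T" by simp
  \<comment> \<open>On (a,b) the squared weight lies between exp (- \<kappa> b) and exp (- \<kappa>
    a), so removing it costs exp (\<kappa> (b - a)).\<close>
  have "(\<Sum>j\<in>?I. nsq ?M (v j)) \<le> (\<Sum>j\<in>?I. exp (\<kappa> * b) * nsq ?M (\<lambda>y. ?e y *\<^sub>R v j y))"
  proof (intro sum_mono nsq_mono)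
    fix j y assume j: "j \<in> ?I" and y: "y \<in> space ?M"
    have "1 \<le> exp (\<kappa> * b) * exp (- \<kappa> * y)" using y \<kappa> by (simp add: exp_add[symmetric])
    then have "1 * (norm (v j y))\<^sup>2 \<le> (exp (\<kappa> * b) * exp (- \<kappa> * y)) * (norm (v j y))\<^sup>2"
      by (intro mult_right_mono) auto
    then show "(norm (v j y))\<^sup>2 \<le> exp (\<kappa> * b) * (norm (?e y *\<^sub>R v j y))\<^sup>2"
      by (simp only: norm_scaleR power_mult_distrib power2_abs sqe mult_1_left mult.assoc)
  qed (rule v L2_exp_weight exp_ge_zero | assumption)+
  also have "\<dots> = exp (\<kappa> * b) * S" by (simp add: S_def sum_distrib_left)
  also have "\<dots> \<le> exp (\<kappa> * b) * (4 * T)" using ST by simp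
  also have "T \<le> (\<Sum>j\<in>?I. exp (- \<kappa> * a) * nsq ?M (r j))"
    unfolding T_def
  proof (intro sum_mono nsq_mono)
    fix j y assume j: "j \<in> ?I" and y: "y \<in> space ?M"
    have "exp (- \<kappa> * y) \<le> exp (- \<kappa> * a)" using y \<kappa> by simp
    then have "exp (- \<kappa> * y) * (norm (r j y))\<^sup>2 \<le> exp (- \<kappa> * a) * (norm (r j y))\<^sup>2"
      by (intro mult_right_mono) auto
    then show "(norm (?e y *\<^sub>R r j y))\<^sup>2 \<le> exp (- \<kappa> * a) * (norm (r j y))\<^sup>2"
      by (simp only: norm_scaleR power_mult_distrib power2_abs sqe)
  qed (rule r L2_exp_weight exp_ge_zero | assumption)+
  also have "exp (\<kappa> * b) * (4 * (\<Sum>j\<in>?I. exp (- \<kappa> * a) * nsq ?M (r j)))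
      = 4 * (exp (\<kappa> * b) * exp (- \<kappa> * a)) * (\<Sum>j\<in>?I. nsq ?M (r j))"
    by (simp add: sum_distrib_left[symmetric])
  also have "exp (\<kappa> * b) * exp (- \<kappa> * a) = exp (\<kappa> * (b - a))"
    by (simp add: algebra_simps flip: exp_add)
  finally show ?thesis by (simp add: \<kappa>_def q_def mult.assoc)
qed

section \<open>The semi-discrete functional\<close>

lemma L2_matrix_vector:
  fixes A :: "real \<Rightarrow> real^'n^'m" and f :: "real \<Rightarrow> real^'n"
  assumes A: "continuous_on {a..b} A" and bound: "\<And>y. y \<in> {a<..<b} \<Longrightarrow> norm (A y) \<le> c"
    and f: "L2 (ivl a b) f"
  shows "L2 (ivl a b) (\<lambda>y. A y *v f y)"
proof (rule L2_bound)
  show "integrable (ivl a b) (\<lambda>y. c\<^sup>2 * (norm (f y))\<^sup>2)" using f by (auto simp: L2_def)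
  have "continuous_on UNIV (\<lambda>p :: (real^'n^'m) \<times> (real^'n). fst p *v snd p)"
    unfolding matrix_vector_mult_def by (intro continuous_intros)
  then show "(\<lambda>y. A y *v f y) \<in> borel_measurable (ivl a b)"
    by (rule borel_measurable_continuous_Pair[OF measurable_ivl_continuous_on[OF A] L2D(1)[OF f]])
  show "(norm (A y *v f y))\<^sup>2 \<le> c\<^sup>2 * (norm (f y))\<^sup>2" if "y \<in> space (ivl a b)" for y
    using that by (intro norm_matrix_vector_sq_le bound) simp
qed

lemma diff_x_diff: "diff_x h (\<lambda>j y. U j y - V j y) j y = diff_x h U j y - diff_x h V j y"
  for U V :: "nat \<Rightarrow> real \<Rightarrow> 'v::euclidean_space"
  by (simp add: diff_x_def algebra_simps)

lemma diff_x_mid: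
  "diff_x h (\<lambda>j y. (1/2) *\<^sub>R (U j y + V j y)) j y = (1/2) *\<^sub>R (diff_x h U j y + diff_x h V j y)"
  for U V :: "nat \<Rightarrow> real \<Rightarrow> 'v::euclidean_space"
  by (simp add: diff_x_def algebra_simps)

text \<open>
  The number \<open>k\<close> bounds \<open>K\<close> uniformly in \<open>h\<close>. The constants defined in this locale depend only on
  \<open>a\<close>, \<open>b\<close>, \<open>h0\<close>, \<open>k\<close> and \<open>C1\<close>, which is the uniformity claimed by the theorem.
\<close>

locale semidiscrete =
  fixes R d a b h h0 k C1 \<epsilon> :: real and K :: nat
    and g :: "real \<times> real \<Rightarrow> real^'n::{finite,linorder}"
  assumes ab: "a < b" and h0: "0 < h0" "h0 \<le> h" and h1: "h < 1" and Kk: "real K \<le> k"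
    and eps: "0 \<le> \<epsilon>" "\<epsilon> < 1"
    and contD: "\<And>j. j \<in> {1..<K} \<Longrightarrow>
      continuous_on {a..b} (D_mat d (grid_pt R h j) :: real \<Rightarrow> real^'n::{finite,linorder}^'n::{finite,linorder})"
    and boundD: "\<And>j y. j \<in> {1..<K} \<Longrightarrow> y \<in> {a..b} \<Longrightarrow>
      norm (D_mat d (grid_pt R h j) y :: real^'n::{finite,linorder}^'n::{finite,linorder}) \<le> C1"
    and contg: "continuous_on {a..b} (\<lambda>y. g (-R, y))" "continuous_on {a..b} (\<lambda>y. g (R, y))"
begin

abbreviation feas :: "(nat \<Rightarrow> real \<Rightarrow> (real, 'n) vec) \<Rightarrow> bool" where "feas \<equiv> feasible R a b K h g"
abbreviation J :: "(nat \<Rightarrow> real \<Rightarrow> (real, 'n) vec) \<Rightarrow> real" where "J \<equiv> J_fun R d a b K h \<epsilon>"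
abbreviation M :: "real measure" where "M \<equiv> ivl a b"
abbreviation I :: "nat set" where "I \<equiv> {1..<K}"

definition w :: "(nat \<Rightarrow> real \<Rightarrow> (real, 'n) vec) \<Rightarrow> nat \<Rightarrow> real \<Rightarrow> (real, 'n) vec" where
  "w U j = wderiv a b (U j)"

definition res :: "(nat \<Rightarrow> real \<Rightarrow> (real, 'n) vec) \<Rightarrow> nat \<Rightarrow> real \<Rightarrow> (real, 'n) vec" where
  "res U j y = w U j y + D_mat d (grid_pt R h j) y *v diff_x h U j y"

text \<open>A squared distance that sees the weak derivatives only. This is enough: interior
  components vanish at \<open>a\<close> and boundary components are prescribed.\<close>

definition dst :: "(nat \<Rightarrow> real \<Rightarrow> (real, 'n) vec) \<Rightarrow> (nat \<Rightarrow> real \<Rightarrow> (real, 'n) vec) \<Rightarrow> real" where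
  "dst U V = (\<Sum>j\<in>I. nsq M (\<lambda>y. w U j y - w V j y))"

lemma feasD:
  assumes "feas U" "j \<in> I"
  shows "continuous_on {a..b} (U j)" "has_weak_derivative a b (U j) (w U j)" "L2 M (w U j)"
    "L2 M (diff_x h U j)" "L2 M (U j)" "U j a = 0" "U j b = g (grid_pt R h j, b)"
  using assms
  by (auto simp: feasible_def H1h_def square_integrable_iff_L2 w_def intro!: has_weak_derivative_wderiv)

lemma feas_boundary:
  assumes "feas U" "y \<in> {a..b}"
  shows "U 0 y = g (-R, y)" "U K y = g (R, y)"
  using assms by (auto simp: feasible_def)

lemma feas_prim:
  assumes "feas U" "j \<in> I" "y \<in> {a..b}"
  shows "U j y = prim a b (w U j) y"
  using weak_derivative_prim[OF feasD(2)[OF assms(1,2)] feasD(1)[OF assms(1,2)] feasD(3)[OF assms(1,2)] assms(3) ab]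
    feasD(6)[OF assms(1,2)] by simp

lemma L2_D:
  fixes f :: "real \<Rightarrow> (real, 'n) vec"
  assumes j: "j \<in> I" and f: "L2 M f"
  shows "L2 M (\<lambda>y. D_mat d (grid_pt R h j) y *v f y)"
  by (rule L2_matrix_vector[OF contD[OF j] _ f]) (rule boundD[OF j], simp)

lemma L2_res:
  assumes "feas U" "j \<in> I"
  shows "L2 M (res U j)"
  unfolding res_def by (intro L2_add L2_D feasD(3,4) assms)

lemma nsq_D_le:
  fixes f :: "real \<Rightarrow> (real, 'n) vec"
  assumes "j \<in> I" "L2 M f"
  shows "nsq M (\<lambda>y. D_mat d (grid_pt R h j) y *v f y) \<le> C1\<^sup>2 * nsq M f"
proof (rule nsq_mono[OF L2_D[OF assms] assms(2)])
  show "(norm (D_mat d (grid_pt R h j) y *v f y))\<^sup>2 \<le> C1\<^sup>2 * (norm (f y))\<^sup>2" if "y \<in> space M" for y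
    using that by (intro norm_matrix_vector_sq_le boundD assms(1)) simp
qed simp

lemma H1_eq:
  assumes "feas U"
  shows "H1h_norm_sq a b K h U = (\<Sum>j\<in>I. h * (nsq M (diff_x h U j) + nsq M (w U j) + nsq M (U j)))"
  unfolding H1h_norm_sq_def set_LINT_ivl
proof (intro sum.cong refl)
  fix j assume j: "j \<in> I"
  note i = feasD(3-5)[OF assms j, THEN L2D(2)]
  show "h * (LINT y|M. (norm (diff_x h U j y))\<^sup>2 + (norm (wderiv a b (U j) y))\<^sup>2 + (norm (U j y))\<^sup>2)
      = h * (nsq M (diff_x h U j) + nsq M (w U j) + nsq M (U j))"
    using i by (simp add: nsq_def w_def)
qed

lemma J_eq: "J U = (\<Sum>j\<in>I. h * nsq M (res U j)) + \<epsilon> * H1h_norm_sq a b K h U"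
  unfolding J_fun_def L2h_norm_sq_def set_LINT_ivl nsq_def res_def w_def ..

lemma H1_nonneg: "feas U \<Longrightarrow> 0 \<le> H1h_norm_sq a b K h U"
  unfolding H1_eq using h0 by (intro sum_nonneg mult_nonneg_nonneg add_nonneg_nonneg) auto

lemma J_nonneg: "feas U \<Longrightarrow> 0 \<le> J U"
  unfolding J_eq using h0 eps H1_nonneg by (intro add_nonneg_nonneg sum_nonneg mult_nonneg_nonneg) auto

lemma dst_nonneg: "0 \<le> dst U V"
  unfolding dst_def by (intro sum_nonneg) simp

lemma nsq_w_le_dst: "j \<in> I \<Longrightarrow> nsq M (\<lambda>y. w U j y - w V j y) \<le> dst U V"
  unfolding dst_def by (rule member_le_sum) auto

lemma diff_prim:
  assumes "feas U" "feas V" "j \<in> I" "y \<in> {a..b}"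
  shows "U j y - V j y = prim a b (\<lambda>y. w U j y - w V j y) y"
  using assms by (simp add: feas_prim prim_sub feasD(3))

lemma diff_x_boundary:
  assumes "feas U" "feas V" "y \<in> {a..b}"
  shows "U 0 y - V 0 y = 0" "U K y - V K y = 0"
  using assms by (simp_all add: feas_boundary)

lemma diff_sq_le:
  assumes "feas U" "feas V" "j \<in> I" "y \<in> {a..b}"
  shows "(norm (U j y - V j y))\<^sup>2 \<le> (b - a) * nsq M (\<lambda>y. w U j y - w V j y)"
  unfolding diff_prim[OF assms] by (intro prim_bound L2_diff feasD(3) assms)

section \<open>Comparison of residuals, norms and the functional with \<open>dst\<close>\<close>

definition Ccar :: real where
  "Ccar = 4 * exp ((4 * k * C1\<^sup>2 * (b - a) / h0\<^sup>2 + 1) * (b - a))"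

lemma Ccar_pos: "0 < Ccar" by (simp add: Ccar_def)

text \<open>Applied to the differences of the chosen weak derivatives, for which the first-order
  relation holds at every point. The bound involves the residuals alone, so it is available for
  \<epsilon> = 0.\<close>

lemma coercive:
  assumes U: "feas U" and V: "feas V"
  shows "dst U V \<le> Ccar * (\<Sum>j\<in>I. nsq M (\<lambda>y. res U j y - res V j y))"
  unfolding dst_def Ccar_def
proof (rule Carleman_estimate[OF ab h0 Kk])
  let ?W = "\<lambda>j y. U j y - V j y"
  show "L2 M (\<lambda>y. w U j y - w V j y)" if "j \<in> I" for j
    by (intro L2_diff feasD(3) U V that)
  show "L2 M (\<lambda>y. res U j y - res V j y)" if "j \<in> I" for j
    by (intro L2_diff L2_res U V that)
  show "res U j y - res V j y = w U j y - w V j y + D_mat d (grid_pt R h j) y *v diff_x h ?W j y" for j y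
    by (simp add: res_def diff_x_diff matrix_vector_mult_diff_distrib)
  show "?W j y = prim a b (\<lambda>y. w U j y - w V j y) y" if "j \<in> I" "y \<in> {a<..<b}" for j y
    using that by (intro diff_prim U V) auto
  show "?W 0 y = 0" "?W K y = 0" if "y \<in> {a<..<b}" for y
    using diff_x_boundary[OF U V, of y] that by auto
  show "norm (D_mat d (grid_pt R h j) y :: ((real, 'n) vec, 'n) vec) \<le> C1" if "j \<in> I" "y \<in> {a<..<b}" for j y
    using that by (intro boundD) auto
qed

text \<open>One factor b - a comes from the pointwise bound for primitives, the other from
  integrating it, and h0^2 from the difference quotient.\<close>

definition Cx :: real where "Cx = (b - a)\<^sup>2 / h0\<^sup>2"

lemma nsq_diff_x_le:
  assumes U: "feas U" and V: "feas V" and j: "j \<in> I"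
  shows "nsq M (\<lambda>y. diff_x h U j y - diff_x h V j y) \<le> Cx * dst U V"
proof -
  let ?W = "\<lambda>j y. U j y - V j y"
  have "nsq M (\<lambda>y. diff_x h U j y - diff_x h V j y) \<le> (b - a) * (((b - a) * dst U V) / h0\<^sup>2)"
  proof (rule nsq_le_const)
    show "L2 M (\<lambda>y. diff_x h U j y - diff_x h V j y)" by (intro L2_diff feasD(4) U V j)
    fix y assume y: "y \<in> {a<..<b}"
    then have y': "y \<in> {a..b}" by simp
    have "(norm (diff_x h ?W j y))\<^sup>2 \<le> (\<Sum>i\<in>I. (norm (?W i y))\<^sup>2) / h0\<^sup>2"
      using diff_x_boundary[OF U V y'] by (intro norm_diff_x_sq_le[OF h0 j]) auto
    also have "\<dots> \<le> (\<Sum>i\<in>I. (b - a) * nsq M (\<lambda>y. w U i y - w V i y)) / h0\<^sup>2"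
      by (intro divide_right_mono sum_mono diff_sq_le U V y') auto
    finally show "(norm (diff_x h U j y - diff_x h V j y))\<^sup>2 \<le> (b - a) * dst U V / h0\<^sup>2"
      by (simp add: diff_x_diff dst_def sum_distrib_left)
  qed (use ab in simp)
  then show ?thesis by (simp add: Cx_def power2_eq_square)
qed

lemma nsq_value_le:
  assumes U: "feas U" and V: "feas V" and j: "j \<in> I"
  shows "nsq M (\<lambda>y. U j y - V j y) \<le> (b - a)\<^sup>2 * dst U V"
proof -
  have "nsq M (\<lambda>y. U j y - V j y) \<le> (b - a) * ((b - a) * dst U V)"
  proof (rule nsq_le_const)
    show "L2 M (\<lambda>y. U j y - V j y)" by (intro L2_diff feasD(5) U V j)
    fix y assume "y \<in> {a<..<b}"
    then have "(norm (U j y - V j y))\<^sup>2 \<le> (b - a) * nsq M (\<lambda>y. w U j y - w V j y)"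
      by (intro diff_sq_le U V j) auto
    also have "\<dots> \<le> (b - a) * dst U V" using ab by (intro mult_left_mono nsq_w_le_dst j) auto
    finally show "(norm (U j y - V j y))\<^sup>2 \<le> (b - a) * dst U V" .
  qed (use ab in simp)
  then show ?thesis by (simp add: power2_eq_square)
qed

text \<open>The squared discrete H1 distance, again built from the chosen versions of the weak
  derivatives.\<close>

definition H1dst :: "(nat \<Rightarrow> real \<Rightarrow> (real, 'n) vec) \<Rightarrow> (nat \<Rightarrow> real \<Rightarrow> (real, 'n) vec) \<Rightarrow> real" where
  "H1dst U V = (\<Sum>j\<in>I. h * (nsq M (\<lambda>y. diff_x h U j y - diff_x h V j y)
     + nsq M (\<lambda>y. w U j y - w V j y) + nsq M (\<lambda>y. U j y - V j y)))"

definition CH :: real where "CH = k * (Cx + 1 + (b - a)\<^sup>2)"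

lemma Kk': "real (card I) \<le> k" "0 \<le> k"
  using Kk by auto

text \<open>Since h < 1, the grid weight is estimated by 1 and the number of terms by k, which keeps
  h out of the constants.\<close>

lemma sum_le_k:
  assumes "\<And>j. j \<in> I \<Longrightarrow> f j \<le> c" "0 \<le> c"
  shows "(\<Sum>j\<in>I. h * f j) \<le> k * c"
proof -
  have "(\<Sum>j\<in>I. h * f j) \<le> (\<Sum>j\<in>I. c)"
  proof (rule sum_mono)
    fix j assume "j \<in> I"
    then have "h * f j \<le> h * c" using h0 by (intro mult_left_mono assms) auto
    also have "\<dots> \<le> 1 * c" using h1 assms(2) by (intro mult_right_mono) auto
    finally show "h * f j \<le> c" by simp
  qed
  also have "\<dots> = real (card I) * c" by simp
  also have "\<dots> \<le> k * c" using Kk' assms(2) by (intro mult_right_mono) auto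
  finally show ?thesis .
qed

lemma H1dst_le:
  assumes "feas U" "feas V"
  shows "H1dst U V \<le> CH * dst U V"
proof -
  have "H1dst U V \<le> k * (Cx * dst U V + dst U V + (b - a)\<^sup>2 * dst U V)"
    unfolding H1dst_def
    by (intro sum_le_k add_mono nsq_diff_x_le nsq_w_le_dst nsq_value_le assms add_nonneg_nonneg
        mult_nonneg_nonneg dst_nonneg) (auto simp: Cx_def)
  then show ?thesis by (simp add: CH_def algebra_simps)
qed

definition CR :: real where "CR = k * (2 + 2 * (C1\<^sup>2 * Cx))"

lemma res_dst_le:
  assumes U: "feas U" and V: "feas V"
  shows "(\<Sum>j\<in>I. h * nsq M (\<lambda>y. res U j y - res V j y)) \<le> CR * dst U V"
proof -
  have "(\<Sum>j\<in>I. h * nsq M (\<lambda>y. res U j y - res V j y)) \<le> k * (2 * dst U V + 2 * (C1\<^sup>2 * (Cx * dst U V)))"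
  proof (rule sum_le_k)
    fix j assume j: "j \<in> I"
    let ?x = "\<lambda>y. diff_x h U j y - diff_x h V j y"
    have x: "L2 M ?x" by (intro L2_diff feasD(4) U V j)
    have "(\<lambda>y. res U j y - res V j y) = (\<lambda>y. (w U j y - w V j y) + D_mat d (grid_pt R h j) y *v ?x y)"
      by (simp add: res_def matrix_vector_mult_diff_distrib fun_eq_iff)
    then have "nsq M (\<lambda>y. res U j y - res V j y)
        \<le> 2 * nsq M (\<lambda>y. w U j y - w V j y) + 2 * nsq M (\<lambda>y. D_mat d (grid_pt R h j) y *v ?x y)"
      using nsq_add_le[OF L2_diff[OF feasD(3)[OF U j] feasD(3)[OF V j]] L2_D[OF j x]] by simp
    also have "nsq M (\<lambda>y. D_mat d (grid_pt R h j) y *v ?x y) \<le> C1\<^sup>2 * nsq M ?x" by (rule nsq_D_le[OF j x])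
    also have "C1\<^sup>2 * nsq M ?x \<le> C1\<^sup>2 * (Cx * dst U V)" by (intro mult_left_mono nsq_diff_x_le U V j) simp
    also have "nsq M (\<lambda>y. w U j y - w V j y) \<le> dst U V" by (rule nsq_w_le_dst[OF j])
    finally show "nsq M (\<lambda>y. res U j y - res V j y) \<le> 2 * dst U V + 2 * (C1\<^sup>2 * (Cx * dst U V))" by simp
  next
    show "0 \<le> 2 * dst U V + 2 * (C1\<^sup>2 * (Cx * dst U V))"
      by (intro add_nonneg_nonneg mult_nonneg_nonneg dst_nonneg) (auto simp: Cx_def)
  qed
  then show ?thesis by (simp add: CR_def algebra_simps)
qed

text \<open>The weighted Young inequality applied to each squared norm in J; its error terms are
  bounded by \<open>res_dst_le\<close> and \<open>H1dst_le\<close>.\<close>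

lemma J_lsc:
  assumes U: "feas U" and V: "feas V" and \<eta>: "0 < \<eta>"
  shows "J U \<le> (1 + \<eta>) * J V + (1 + 1 / \<eta>) * ((CR + CH) * dst V U)"
proof -
  have 1: "(\<Sum>j\<in>I. h * nsq M (res U j)) \<le>
      (1 + \<eta>) * (\<Sum>j\<in>I. h * nsq M (res V j)) + (1 + 1 / \<eta>) * (\<Sum>j\<in>I. h * nsq M (\<lambda>y. res U j y - res V j y))"
    unfolding sum_distrib_left sum.distrib[symmetric]
  proof (rule sum_mono)
    fix j assume j: "j \<in> I"
    have "h * nsq M (res U j) \<le> h * ((1 + \<eta>) * nsq M (res V j) + (1 + 1 / \<eta>) * nsq M (\<lambda>y. res U j y - res V j y))"
      using h0 by (intro mult_left_mono nsq_le_weighted L2_res U V j \<eta>) auto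
    then show "h * nsq M (res U j) \<le>
      (1 + \<eta>) * (h * nsq M (res V j)) + (1 + 1 / \<eta>) * (h * nsq M (\<lambda>y. res U j y - res V j y))"
      by (simp add: distrib_left mult.left_commute)
  qed
  have 2: "H1h_norm_sq a b K h U \<le> (1 + \<eta>) * H1h_norm_sq a b K h V + (1 + 1 / \<eta>) * H1dst U V"
    unfolding H1_eq[OF U] H1_eq[OF V] H1dst_def sum_distrib_left sum.distrib[symmetric]
  proof (rule sum_mono)
    fix j assume j: "j \<in> I"
    have "nsq M (diff_x h U j) + nsq M (w U j) + nsq M (U j) \<le>
      ((1 + \<eta>) * nsq M (diff_x h V j) + (1 + 1 / \<eta>) * nsq M (\<lambda>y. diff_x h U j y - diff_x h V j y)) +
      ((1 + \<eta>) * nsq M (w V j) + (1 + 1 / \<eta>) * nsq M (\<lambda>y. w U j y - w V j y)) +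
      ((1 + \<eta>) * nsq M (V j) + (1 + 1 / \<eta>) * nsq M (\<lambda>y. U j y - V j y))"
      by (intro add_mono nsq_le_weighted feasD(3-5) U V j \<eta>)
    also have "\<dots> = (1 + \<eta>) * (nsq M (diff_x h V j) + nsq M (w V j) + nsq M (V j)) +
      (1 + 1 / \<eta>) * (nsq M (\<lambda>y. diff_x h U j y - diff_x h V j y) + nsq M (\<lambda>y. w U j y - w V j y)
        + nsq M (\<lambda>y. U j y - V j y))" (is "_ = (1 + \<eta>) * ?p + (1 + 1 / \<eta>) * ?q")
      by (simp only: distrib_left add_ac)
    finally have "h * (nsq M (diff_x h U j) + nsq M (w U j) + nsq M (U j)) \<le> h * ((1 + \<eta>) * ?p + (1 + 1 / \<eta>) * ?q)"
      using h0 by (intro mult_left_mono) auto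
    also have "\<dots> = (1 + \<eta>) * (h * ?p) + (1 + 1 / \<eta>) * (h * ?q)"
      by (simp only: distrib_left[of h] mult.left_commute[of h])
    finally show "h * (nsq M (diff_x h U j) + nsq M (w U j) + nsq M (U j))
      \<le> (1 + \<eta>) * (h * ?p) + (1 + 1 / \<eta>) * (h * ?q)" .
  qed
  have pos: "0 \<le> H1dst U V"
    unfolding H1dst_def using h0 by (intro sum_nonneg mult_nonneg_nonneg add_nonneg_nonneg) auto
  have sym: "dst V U = dst U V" unfolding dst_def by (intro sum.cong refl nsq_minus_commute)
  \<comment> \<open>\<epsilon> < 1 lets the same constant serve every \<epsilon>.\<close>
  have "(\<Sum>j\<in>I. h * nsq M (\<lambda>y. res U j y - res V j y)) + \<epsilon> * H1dst U V \<le> CR * dst U V + CH * dst U V"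
    using res_dst_le[OF U V] H1dst_le[OF U V] mult_right_mono[OF less_imp_le[OF eps(2)] pos] by linarith
  then have 3: "(1 + 1 / \<eta>) * ((\<Sum>j\<in>I. h * nsq M (\<lambda>y. res U j y - res V j y)) + \<epsilon> * H1dst U V)
      \<le> (1 + 1 / \<eta>) * ((CR + CH) * dst V U)"
    using \<eta> unfolding sym by (intro mult_left_mono) (auto simp: distrib_right)
  have 4: "\<epsilon> * H1h_norm_sq a b K h U \<le> \<epsilon> * ((1 + \<eta>) * H1h_norm_sq a b K h V + (1 + 1 / \<eta>) * H1dst U V)"
    using 2 eps by (intro mult_left_mono) auto
  show ?thesis using 1 3 4 unfolding J_eq by (simp add: algebra_simps)
qed

lemma feas_mid:
  assumes U: "feas U" and V: "feas V"
  shows "feas (\<lambda>j y. (1/2) *\<^sub>R (U j y + V j y))" (is "feas ?m")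
    and "j \<in> I \<Longrightarrow> AE y in M. w (\<lambda>j y. (1/2) *\<^sub>R (U j y + V j y)) j y = (1/2) *\<^sub>R (w U j y + w V j y)"
proof -
  have wd: "has_weak_derivative a b (?m j) (\<lambda>y. (1/2) *\<^sub>R (w U j y + w V j y))" if "j \<in> I" for j
    by (intro has_weak_derivative_mid feasD(2,3,5) U V that)
  have cm: "continuous_on {a..b} (?m j)" if "j \<in> I" for j
    by (intro continuous_intros feasD(1) U V that)
  have L: "L2 M (\<lambda>y. (1/2) *\<^sub>R (w U j y + w V j y))" if "j \<in> I" for j
    by (intro L2_scaleR L2_add feasD(3) U V that)
  have "H1h a b K h ?m"
    unfolding H1h_def square_integrable_iff_L2
  proof (intro ballI conjI)
    fix j assume j: "j \<in> I"
    show "continuous_on {a..b} (?m j)" by (rule cm[OF j])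
    show "weakly_differentiable a b (?m j)" using wd[OF j] by (auto simp: weakly_differentiable_def)
    show "L2 M (diff_x h ?m j)"
      unfolding diff_x_mid by (intro L2_scaleR L2_add feasD(4) U V j)
    show "L2 M (wderiv a b (?m j))" by (rule wderiv_measurable_L2[OF wd[OF j] cm[OF j] L[OF j]])
    show "L2 M (?m j)" by (intro L2_scaleR L2_add feasD(5) U V j)
  qed
  moreover have "(1/2) *\<^sub>R (x + x) = x" for x :: "(real, 'n) vec"
    by (simp flip: scaleR_2)
  ultimately show "feas ?m"
    using feasD(6,7)[OF U] feasD(6,7)[OF V] feas_boundary[OF U] feas_boundary[OF V]
    by (simp add: feasible_def)
  show "AE y in M. w ?m j y = (1/2) *\<^sub>R (w U j y + w V j y)" if "j \<in> I"
    using wderiv_AE[OF wd[OF that] cm[OF that]] unfolding w_def by eventually_elim simp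
qed

text \<open>The 1/2 is that of the parallelogram law, \<open>h0\<close> bounds the grid weight from
  below, and 1 / \<open>Ccar\<close> comes from coercivity.\<close>

definition Cmid :: real where "Cmid = h0 / (2 * Ccar)"

lemma Cmid_pos: "0 < Cmid"
  using h0 Ccar_pos by (simp add: Cmid_def)

lemma J_mid:
  assumes U: "feas U" and V: "feas V"
  shows "\<exists>m\<in>Collect feas. Cmid * dst U V \<le> J U + J V - 2 * J m"
proof
  let ?m = "\<lambda>j y. (1/2) *\<^sub>R (U j y + V j y)"
  note m = feas_mid(1)[OF U V]
  show "?m \<in> Collect feas" using m by simp
  \<comment> \<open>The derivative chosen for the midpoint agrees with the midpoint of the
    derivatives almost everywhere, which suffices under the integral.\<close>
  have wm: "nsq M (w ?m j) = nsq M (\<lambda>y. (1/2) *\<^sub>R (w U j y + w V j y))" if "j \<in> I" for j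
    using feas_mid(2)[OF U V that] L2D(1)[OF feasD(3)[OF m that]]
      L2D(1)[OF L2_scaleR[OF L2_add[OF feasD(3)[OF U that] feasD(3)[OF V that]], of "1/2"]]
    by (rule nsq_cong_AE)
  have rm: "nsq M (res ?m j) = nsq M (\<lambda>y. (1/2) *\<^sub>R (res U j y + res V j y))" if "j \<in> I" for j
  proof (rule nsq_cong_AE)
    show "AE y in M. res ?m j y = (1/2) *\<^sub>R (res U j y + res V j y)"
      using feas_mid(2)[OF U V that]
    proof eventually_elim
      case (elim y)
      then show ?case
        unfolding res_def diff_x_mid by (simp add: matrix_vector_mult_scaleR matrix_vector_right_distrib algebra_simps)
    qed
    show "res ?m j \<in> borel_measurable M" using L2_res[OF m that] by (rule L2D(1))
    show "(\<lambda>y. (1/2) *\<^sub>R (res U j y + res V j y)) \<in> borel_measurable M"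
      by (rule L2D(1)[OF L2_scaleR[OF L2_add[OF L2_res[OF U that] L2_res[OF V that]]]])
  qed
  have "(\<Sum>j\<in>I. h * nsq M (res U j)) + (\<Sum>j\<in>I. h * nsq M (res V j)) - 2 * (\<Sum>j\<in>I. h * nsq M (res ?m j))
      = (\<Sum>j\<in>I. h * (nsq M (res U j) + nsq M (res V j) - 2 * nsq M (res ?m j)))"
    by (simp add: sum_distrib_left sum.distrib sum_subtractf algebra_simps)
  also have "\<dots> = (\<Sum>j\<in>I. h * (nsq M (\<lambda>y. res U j y - res V j y) / 2))"
    using nsq_mid[OF L2_res[OF U] L2_res[OF V]] by (intro sum.cong refl) (simp add: rm)
  also have "\<dots> \<ge> (\<Sum>j\<in>I. h0 * (nsq M (\<lambda>y. res U j y - res V j y) / 2))"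
    using h0 by (intro sum_mono mult_right_mono) auto
  also have "(\<Sum>j\<in>I. h0 * (nsq M (\<lambda>y. res U j y - res V j y) / 2))
      = h0 / 2 * (\<Sum>j\<in>I. nsq M (\<lambda>y. res U j y - res V j y))"
    by (simp add: sum_distrib_left)
  also have "h0 / 2 * (\<Sum>j\<in>I. nsq M (\<lambda>y. res U j y - res V j y)) \<ge> Cmid * dst U V"
  proof -
    have "Cmid * dst U V \<le> Cmid * (Ccar * (\<Sum>j\<in>I. nsq M (\<lambda>y. res U j y - res V j y)))"
      using Cmid_pos by (intro mult_left_mono coercive U V) auto
    then show ?thesis using Ccar_pos by (simp add: Cmid_def)
  qed
  finally have 1: "Cmid * dst U V \<le> (\<Sum>j\<in>I. h * nsq M (res U j)) + (\<Sum>j\<in>I. h * nsq M (res V j))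
      - 2 * (\<Sum>j\<in>I. h * nsq M (res ?m j))" .
  have "H1h_norm_sq a b K h U + H1h_norm_sq a b K h V - 2 * H1h_norm_sq a b K h ?m
      = (\<Sum>j\<in>I. h * ((nsq M (diff_x h U j) + nsq M (diff_x h V j) - 2 * nsq M (diff_x h ?m j))
        + (nsq M (w U j) + nsq M (w V j) - 2 * nsq M (w ?m j))
        + (nsq M (U j) + nsq M (V j) - 2 * nsq M (?m j))))"
    unfolding H1_eq[OF U] H1_eq[OF V] H1_eq[OF m]
    by (simp add: sum_distrib_left sum.distrib sum_subtractf algebra_simps)
  \<comment> \<open>The regularization term is only shown to be midpoint convex. The whole gain
    comes from the residuals, so \<open>Cmid\<close> does not involve \<epsilon>.\<close>
  also have "\<dots> \<ge> 0"
  proof (intro sum_nonneg mult_nonneg_nonneg add_nonneg_nonneg)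
    fix j assume j: "j \<in> I"
    show "0 \<le> nsq M (diff_x h U j) + nsq M (diff_x h V j) - 2 * nsq M (diff_x h ?m j)"
      unfolding diff_x_mid nsq_mid[OF feasD(4)[OF U j] feasD(4)[OF V j]] by simp
    show "0 \<le> nsq M (w U j) + nsq M (w V j) - 2 * nsq M (w ?m j)"
      unfolding wm[OF j] nsq_mid[OF feasD(3)[OF U j] feasD(3)[OF V j]] by simp
    show "0 \<le> nsq M (U j) + nsq M (V j) - 2 * nsq M (?m j)"
      unfolding nsq_mid[OF feasD(5)[OF U j] feasD(5)[OF V j]] by simp
  qed (use h0 in simp)
  finally have "0 \<le> \<epsilon> * (H1h_norm_sq a b K h U + H1h_norm_sq a b K h V - 2 * H1h_norm_sq a b K h ?m)"
    using eps by simp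
  then show "Cmid * dst U V \<le> J U + J V - 2 * J ?m"
    using 1 unfolding J_eq by (simp add: algebra_simps)
qed

text \<open>The limit is assembled from primitives of the L2 limits of the weak derivatives. The
  pointwise bound for primitives makes the components converge uniformly, so the values at
  \<open>b\<close> survive.\<close>

lemma feas_complete:
  assumes X: "\<And>n. feas (X n)"
    and Cau: "\<And>e. e > 0 \<Longrightarrow> \<exists>N. \<forall>m\<ge>N. \<forall>n\<ge>N. dst (X m) (X n) < e"
  shows "\<exists>U\<in>Collect feas. (\<lambda>n::nat. dst (X n) U) \<longlonglongrightarrow> 0"
proof -
  have ex: "\<exists>v. L2 M v \<and> (\<lambda>n. nsq M (\<lambda>y. w (X n) j y - v y)) \<longlonglongrightarrow> 0" if j: "j \<in> I" for j
  proof -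
    have "\<exists>N. \<forall>m\<ge>N. \<forall>n\<ge>N. nsq M (\<lambda>y. w (X m) j y - w (X n) j y) < e" if e: "e > 0" for e
    proof -
      obtain N where N: "\<And>m n. m \<ge> N \<Longrightarrow> n \<ge> N \<Longrightarrow> dst (X m) (X n) < e"
        using Cau[OF e] by blast
      have "nsq M (\<lambda>y. w (X m) j y - w (X n) j y) < e" if "m \<ge> N" "n \<ge> N" for m n
        using nsq_w_le_dst[OF j, of "X m" "X n"] N[OF that] by linarith
      then show ?thesis by blast
    qed
    from finite_measure.Riesz_Fischer[OF finite_measure_ivl feasD(3)[OF X j] this]
    obtain v where "L2 M v" "(\<lambda>n. nsq M (\<lambda>y. w (X n) j y - v y)) \<longlonglongrightarrow> 0" .
    then show ?thesis by blast
  qed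
  have "\<exists>v. \<forall>j\<in>I. L2 M (v j) \<and> (\<lambda>n. nsq M (\<lambda>y. w (X n) j y - v j y)) \<longlonglongrightarrow> 0"
    by (rule bchoice) (intro ballI ex)
  then obtain v where vI: "\<forall>j\<in>I. L2 M (v j) \<and> (\<lambda>n. nsq M (\<lambda>y. w (X n) j y - v j y)) \<longlonglongrightarrow> 0" ..
  have v: "L2 M (v j)" "(\<lambda>n. nsq M (\<lambda>y. w (X n) j y - v j y)) \<longlonglongrightarrow> 0" if "j \<in> I" for j
    by (rule bspec[OF vI that, THEN conjunct1] bspec[OF vI that, THEN conjunct2])+
  define U where "U j = (if j = 0 then \<lambda>y. g (-R, y) else if j = K then \<lambda>y. g (R, y) else prim a b (v j))" for j
  have UI: "U j = prim a b (v j)" if "j \<in> I" for j using that by (simp add: U_def)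
  \<comment> \<open>Continuity of the two boundary components comes from the data on the lateral
    sides; it makes the difference quotients next to the boundary square integrable.\<close>
  have cU: "continuous_on {a..b} (U j)" if "j \<le> K" for j
  proof (cases "j \<in> I")
    case True
    then show ?thesis using UI v(1) continuous_on_prim by metis
  next
    case False
    then have "j = 0 \<or> j = K" using that by auto
    then show ?thesis using contg unfolding U_def by (cases "j = 0") simp_all
  qed
  have pt: "(norm (X n j y - U j y))\<^sup>2 \<le> (b - a) * nsq M (\<lambda>y. w (X n) j y - v j y)"
    if "j \<in> I" "y \<in> {a..b}" for n j y
    using prim_bound[OF L2_diff[OF feasD(3)[OF X that(1)] v(1)[OF that(1)]] that(2), of n]
    by (simp add: prim_sub feasD(3)[OF X that(1)] v(1)[OF that(1)] feas_prim[OF X that] UI[OF that(1)])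
  have lim0: "(\<lambda>n. c * nsq M (\<lambda>y. w (X n) j y - v j y)) \<longlonglongrightarrow> 0" if "j \<in> I" for j c
    using tendsto_mult_right_zero[OF v(2)[OF that]] .
  have limU: "(\<lambda>n. nsq M (\<lambda>y. X n j y - U j y)) \<longlonglongrightarrow> 0" if j: "j \<in> I" for j
  proof (rule tendsto_sandwich[OF always_eventually always_eventually tendsto_const lim0[OF j, of "(b - a) * (b - a)"]])
    show "\<forall>n. nsq M (\<lambda>y. X n j y - U j y) \<le> (b - a) * (b - a) * nsq M (\<lambda>y. w (X n) j y - v j y)"
    proof
      fix n
      show "nsq M (\<lambda>y. X n j y - U j y) \<le> (b - a) * (b - a) * nsq M (\<lambda>y. w (X n) j y - v j y)"
        unfolding mult.assoc
      proof (rule nsq_le_const)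
        show "L2 M (\<lambda>y. X n j y - U j y)"
          using j by (intro L2_diff feasD(5) X L2_continuous_on cU) simp_all
        show "(norm (X n j y - U j y))\<^sup>2 \<le> (b - a) * nsq M (\<lambda>y. w (X n) j y - v j y)" if "y \<in> {a<..<b}" for y
          using that by (intro pt j) simp
      qed (use ab in simp)
    qed
  qed simp
  have wd: "has_weak_derivative a b (U j) (v j)" if j: "j \<in> I" for j
    by (rule has_weak_derivative_limit[OF feasD(2,5,3)[OF X j] L2_continuous_on[OF cU] v(1)[OF j] limU[OF j] v(2)[OF j]])
      (use j in simp)
  have bd: "U j b = g (grid_pt R h j, b)" if j: "j \<in> I" for j
  proof -
    \<comment> \<open>The left side does not depend on n while the right side tends to 0.\<close>
    have "(norm (g (grid_pt R h j, b) - U j b))\<^sup>2 \<le> (b - a) * nsq M (\<lambda>y. w (X n) j y - v j y)" for n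
      using pt[OF j, of b n] ab by (simp add: feasD(7)[OF X j])
    then have "(norm (g (grid_pt R h j, b) - U j b))\<^sup>2 \<le> 0"
      by (intro LIMSEQ_le_const[OF lim0[OF j, of "b - a"]]) blast
    then show ?thesis by simp
  qed
  have Lw: "L2 M (wderiv a b (U j))" if j: "j \<in> I" for j
    by (rule wderiv_measurable_L2[OF wd[OF j] cU v(1)[OF j]]) (use j in simp)
  have "H1h a b K h U"
    unfolding H1h_def square_integrable_iff_L2
  proof (intro ballI conjI)
    fix j assume j: "j \<in> I"
    show "continuous_on {a..b} (U j)" using j by (intro cU) simp
    show "weakly_differentiable a b (U j)" using wd[OF j] by (auto simp: weakly_differentiable_def)
    show "L2 M (diff_x h U j)"
      unfolding diff_x_def using j by (intro L2_continuous_on continuous_intros cU) auto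
    show "L2 M (wderiv a b (U j))" by (rule Lw[OF j])
    show "L2 M (U j)" using j by (intro L2_continuous_on cU) simp
  qed
  moreover have "U j a = 0" if "j \<in> I" for j using UI[OF that] by (simp add: prim_le_a)
  moreover have "U 0 y = g (-R, y)" for y by (simp add: U_def)
  moreover have "U K y = g (R, y)" if "y \<in> {a..b}" for y
  \<comment> \<open>For K = 0 both boundary conditions concern the same component; they are
    compatible because \<open>X 0\<close> is feasible.\<close>
  proof (cases "K = 0")
    case True
    then show ?thesis using feas_boundary[OF X[of 0] that] by (simp add: U_def)
  qed (simp add: U_def)
  ultimately have "feas U" using bd by (simp add: feasible_def)
  moreover have "(\<lambda>n. dst (X n) U) \<longlonglongrightarrow> 0"
  proof -
    have "nsq M (\<lambda>y. w (X n) j y - w U j y) = nsq M (\<lambda>y. w (X n) j y - v j y)" if j: "j \<in> I" for n j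
    proof (rule nsq_cong_AE)
      have "AE y in M. v j y = w U j y" unfolding w_def
        by (rule wderiv_AE[OF wd[OF j] cU]) (use j in simp)
      then show "AE y in M. w (X n) j y - w U j y = w (X n) j y - v j y" by eventually_elim simp
      show "(\<lambda>y. w (X n) j y - w U j y) \<in> borel_measurable M"
        using L2_diff[OF feasD(3)[OF X j] Lw[OF j], of n] unfolding w_def by (rule L2D(1))
      show "(\<lambda>y. w (X n) j y - v j y) \<in> borel_measurable M"
        using L2_diff[OF feasD(3)[OF X j] v(1)[OF j]] by (rule L2D(1))
    qed
    then have "(\<lambda>n. dst (X n) U) = (\<lambda>n. \<Sum>j\<in>I. nsq M (\<lambda>y. w (X n) j y - v j y))"
      by (simp add: dst_def)
    moreover have "(\<lambda>n. \<Sum>j\<in>I. nsq M (\<lambda>y. w (X n) j y - v j y)) \<longlonglongrightarrow> (\<Sum>j\<in>I. 0)"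
      by (intro tendsto_sum v(2))
    ultimately show ?thesis by simp
  qed
  ultimately show ?thesis by blast
qed

text \<open>Interior components are primitives of their weak derivatives, so equality holds at every
  point of [a,b] and not just almost everywhere.\<close>

lemma dst_0_eq:
  assumes U: "feas U" and V: "feas V" and 0: "dst U V \<le> 0" and "i \<le> K" and y: "y \<in> {a..b}"
  shows "U i y = V i y"
proof (cases "i \<in> I")
  case True
  have "nsq M (\<lambda>y. w U i y - w V i y) \<le> 0" using nsq_w_le_dst[OF True, of U V] 0 by linarith
  then have "(b - a) * nsq M (\<lambda>y. w U i y - w V i y) \<le> 0" using ab by (intro mult_nonneg_nonpos) auto
  then have "(norm (U i y - V i y))\<^sup>2 \<le> 0" using diff_sq_le[OF U V True y] by linarith
  then show ?thesis by simp
next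
  case False
  then have "i = 0 \<or> i = K" using \<open>i \<le> K\<close> by auto
  then show ?thesis using diff_x_boundary[OF U V y] by auto
qed

text \<open>The functional at F is at most 3 + 2 C1^2 times its squared norm. Both residual sums are
  below that value, which gives 4 / h0 for the difference of residuals; \<open>Ccar\<close> and
  \<open>CH\<close> convert this into the norm of U - F, and the 2's come from the triangle
  inequality.\<close>

definition CF :: real where "CF = 2 + 2 * (CH * (4 * Ccar / h0 * (3 + 2 * C1\<^sup>2)))"

lemma minimizer_bound:
  assumes U: "feas U" and F: "feas F" and le: "J U \<le> J F"
  shows "H1h_norm_sq a b K h U \<le> CF * H1h_norm_sq a b K h F"
proof -
  let ?HU = "H1h_norm_sq a b K h U" and ?HF = "H1h_norm_sq a b K h F"
  define rU where "rU = (\<Sum>j\<in>I. h * nsq M (res U j))"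
  define rF where "rF = (\<Sum>j\<in>I. h * nsq M (res F j))"
  have HU: "0 \<le> ?HU" and HF: "0 \<le> ?HF" using H1_nonneg U F by auto
  have "rF \<le> (\<Sum>j\<in>I. (2 + 2 * C1\<^sup>2) * (h * (nsq M (diff_x h F j) + nsq M (w F j) + nsq M (F j))))"
    unfolding rF_def
  proof (rule sum_mono)
    fix j assume j: "j \<in> I"
    have "nsq M (res F j) \<le> 2 * nsq M (w F j) + 2 * nsq M (\<lambda>y. D_mat d (grid_pt R h j) y *v diff_x h F j y)"
      unfolding res_def by (rule nsq_add_le[OF feasD(3)[OF F j] L2_D[OF j feasD(4)[OF F j]]])
    also have "\<dots> \<le> 2 * nsq M (w F j) + 2 * (C1\<^sup>2 * nsq M (diff_x h F j))"
      using nsq_D_le[OF j feasD(4)[OF F j]] by simp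
    also have "\<dots> \<le> (2 + 2 * C1\<^sup>2) * (nsq M (diff_x h F j) + nsq M (w F j) + nsq M (F j))"
    proof -
      have "0 \<le> 2 * nsq M (diff_x h F j) + 2 * nsq M (F j) + 2 * C1\<^sup>2 * (nsq M (w F j) + nsq M (F j))"
        by (intro add_nonneg_nonneg mult_nonneg_nonneg) auto
      then show ?thesis by (simp add: algebra_simps)
    qed
    finally have "h * nsq M (res F j) \<le> h * ((2 + 2 * C1\<^sup>2) * (nsq M (diff_x h F j) + nsq M (w F j) + nsq M (F j)))"
      using h0 by (intro mult_left_mono) auto
    then show "h * nsq M (res F j) \<le> (2 + 2 * C1\<^sup>2) * (h * (nsq M (diff_x h F j) + nsq M (w F j) + nsq M (F j)))"
      by (simp only: mult.left_commute)
  qed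
  also have "\<dots> = (2 + 2 * C1\<^sup>2) * ?HF" by (simp only: H1_eq[OF F] sum_distrib_left)
  finally have rF: "rF \<le> (2 + 2 * C1\<^sup>2) * ?HF" .
  have "\<epsilon> * ?HF \<le> 1 * ?HF" using eps HF by (intro mult_right_mono) auto
  \<comment> \<open>2 + 2 C1^2 bounds the residual part, and \<epsilon> < 1 adds one more
    unit.\<close>
  then have JF: "J F \<le> (3 + 2 * C1\<^sup>2) * ?HF" using rF unfolding J_eq rF_def[symmetric] by (simp add: algebra_simps)
  have rU_le: "rU \<le> J F" using le mult_nonneg_nonneg[OF eps(1) HU] unfolding J_eq[of U] rU_def by linarith
  have rF_le: "rF \<le> J F" using mult_nonneg_nonneg[OF eps(1) HF] unfolding J_eq[of F] rF_def by linarith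
  have "h0 * (\<Sum>j\<in>I. nsq M (\<lambda>y. res U j y - res F j y)) \<le> (\<Sum>j\<in>I. 2 * (h * nsq M (res U j)) + 2 * (h * nsq M (res F j)))"
    unfolding sum_distrib_left
  proof (rule sum_mono)
    fix j assume j: "j \<in> I"
    have "h0 * nsq M (\<lambda>y. res U j y - res F j y) \<le> h * nsq M (\<lambda>y. res U j y - res F j y)"
      using h0 by (intro mult_right_mono) auto
    also have "\<dots> \<le> h * (2 * nsq M (res U j) + 2 * nsq M (res F j))"
      using h0 by (intro mult_left_mono nsq_diff_le L2_res U F j) auto
    finally show "h0 * nsq M (\<lambda>y. res U j y - res F j y) \<le> 2 * (h * nsq M (res U j)) + 2 * (h * nsq M (res F j))"
      by (simp add: algebra_simps)
  qed
  also have "\<dots> = 2 * rU + 2 * rF" by (simp add: sum.distrib sum_distrib_left rU_def rF_def)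
  also have "\<dots> \<le> 4 * ((3 + 2 * C1\<^sup>2) * ?HF)" using rU_le rF_le JF by linarith
  finally have "(\<Sum>j\<in>I. nsq M (\<lambda>y. res U j y - res F j y)) \<le> 4 * ((3 + 2 * C1\<^sup>2) * ?HF) / h0"
    using h0 by (simp add: pos_le_divide_eq mult.commute)
  then have "Ccar * (\<Sum>j\<in>I. nsq M (\<lambda>y. res U j y - res F j y)) \<le> Ccar * (4 * ((3 + 2 * C1\<^sup>2) * ?HF) / h0)"
    using Ccar_pos by (intro mult_left_mono) auto
  then have d: "dst U F \<le> Ccar * (4 * ((3 + 2 * C1\<^sup>2) * ?HF) / h0)" using coercive[OF U F] by linarith
  have CH: "0 \<le> CH" unfolding CH_def Cx_def using Kk' by (intro mult_nonneg_nonneg) auto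
  have "?HU \<le> (\<Sum>j\<in>I. 2 * (h * (nsq M (diff_x h F j) + nsq M (w F j) + nsq M (F j)))
      + 2 * (h * (nsq M (\<lambda>y. diff_x h U j y - diff_x h F j y) + nsq M (\<lambda>y. w U j y - w F j y) + nsq M (\<lambda>y. U j y - F j y))))"
    unfolding H1_eq[OF U]
  proof (rule sum_mono)
    fix j assume j: "j \<in> I"
    have tri: "nsq M p \<le> 2 * nsq M q + 2 * nsq M (\<lambda>y. p y - q y)" if "L2 M p" "L2 M q" for p q :: "real \<Rightarrow> (real, 'n) vec"
      using nsq_add_le[OF that(2) L2_diff[OF that]] by simp
    have "nsq M (diff_x h U j) + nsq M (w U j) + nsq M (U j) \<le>
      (2 * nsq M (diff_x h F j) + 2 * nsq M (\<lambda>y. diff_x h U j y - diff_x h F j y)) +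
      (2 * nsq M (w F j) + 2 * nsq M (\<lambda>y. w U j y - w F j y)) +
      (2 * nsq M (F j) + 2 * nsq M (\<lambda>y. U j y - F j y))"
      by (intro add_mono tri feasD(3-5) U F j)
    then have "h * (nsq M (diff_x h U j) + nsq M (w U j) + nsq M (U j)) \<le> h * (
      (2 * nsq M (diff_x h F j) + 2 * nsq M (\<lambda>y. diff_x h U j y - diff_x h F j y)) +
      (2 * nsq M (w F j) + 2 * nsq M (\<lambda>y. w U j y - w F j y)) +
      (2 * nsq M (F j) + 2 * nsq M (\<lambda>y. U j y - F j y)))"
      using h0 by (intro mult_left_mono) auto
    then show "h * (nsq M (diff_x h U j) + nsq M (w U j) + nsq M (U j)) \<le>
      2 * (h * (nsq M (diff_x h F j) + nsq M (w F j) + nsq M (F j)))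
      + 2 * (h * (nsq M (\<lambda>y. diff_x h U j y - diff_x h F j y) + nsq M (\<lambda>y. w U j y - w F j y) + nsq M (\<lambda>y. U j y - F j y)))"
      by (simp add: algebra_simps)
  qed
  also have "\<dots> = 2 * ?HF + 2 * H1dst U F"
    by (simp only: H1_eq[OF F] H1dst_def sum.distrib sum_distrib_left)
  also have "\<dots> \<le> 2 * ?HF + 2 * (CH * (Ccar * (4 * ((3 + 2 * C1\<^sup>2) * ?HF) / h0)))"
    using H1dst_le[OF U F] mult_left_mono[OF d CH] by linarith
  also have "\<dots> = CF * ?HF" by (simp add: CF_def algebra_simps)
  finally show ?thesis .
qed

lemma minimizer_exists:
  assumes F: "feas F"
  shows "\<exists>U. is_arg_min J feas U \<and>
    (\<forall>V. is_arg_min J feas V \<longrightarrow> (\<forall>i\<le>K. \<forall>y\<in>{a..b}. V i y = U i y)) \<and>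
    H1h_norm a b K h U \<le> sqrt CF * H1h_norm a b K h F"
proof -
  have "\<exists>U\<in>Collect feas. \<forall>V\<in>Collect feas. J U \<le> J V"
  proof (rule quadratic_minimizer_exists[where dst = dst and c = Cmid and B = "CR + CH"])
    show "Collect feas \<noteq> {}" using F by auto
  qed (use Cmid_pos J_nonneg J_mid J_lsc feas_complete in auto)
  then obtain U where U: "feas U" "\<And>V. feas V \<Longrightarrow> J U \<le> J V" by auto
  have "is_arg_min J feas U" using U by (auto simp: is_arg_min_def not_less)
  moreover have "V i y = U i y" if V: "is_arg_min J feas V" and iy: "i \<le> K" "y \<in> {a..b}" for V i y
  proof -
    have fV: "feas V" "\<And>Z. feas Z \<Longrightarrow> J V \<le> J Z" using V by (auto simp: is_arg_min_def not_less)
    obtain m where m: "feas m" "Cmid * dst V U \<le> J V + J U - 2 * J m" using J_mid[OF fV(1) U(1)] by auto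
    \<comment> \<open>Neither minimizer exceeds the functional at the midpoint m, so the convexity
      gap is at most 0.\<close>
    have "Cmid * dst V U \<le> 0" using m(2) fV(2)[OF m(1)] U(2)[OF m(1)] by linarith
    then have "dst V U \<le> 0" using Cmid_pos by (simp add: mult_le_0_iff)
    then show ?thesis by (rule dst_0_eq[OF fV(1) U(1) _ iy])
  qed
  moreover have "H1h_norm a b K h U \<le> sqrt CF * H1h_norm a b K h F"
    unfolding H1h_norm_def real_sqrt_mult[symmetric]
    using minimizer_bound[OF U(1) F U(2)[OF F]] by simp
  ultimately show ?thesis by blast
qed

end

section \<open>Choice of uniform constants and conclusion\<close>

lemma C1_closed_continuous:
  fixes f :: "real \<Rightarrow> 'v::real_normed_vector"
  assumes "C1_closed a b f"
  shows "continuous_on {a..b} f"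
  using assms unfolding C1_closed_def
  by (meson continuous_on_eq_continuous_within has_vector_derivative_continuous)

theorem theorem4p2:
  fixes R d h0 a0 a b :: real
  assumes "R > 0" and "d > 0" and "0 < h0" and "h0 < 1"
    and "admissible_a0 TYPE('n::{finite,linorder}) R d a0"
    and "a0 \<le> a" and "a < b"
  shows "\<exists>C>0. \<forall>\<epsilon> h. \<forall>K::nat. \<forall>g :: real \<times> real \<Rightarrow> real^'n::{finite,linorder}. \<forall>F :: nat \<Rightarrow> real \<Rightarrow> real^'n::{finite,linorder}.
    0 \<le> \<epsilon> \<and> \<epsilon> < 1 \<and> h0 \<le> h \<and> h < 1 \<and> real K = 2 * R / h \<and>
    (\<forall>x\<in>{-R..R}. g (x, a) = 0) \<and>
    C1_closed a b (\<lambda>y. g (-R, y)) \<and> C1_closed a b (\<lambda>y. g (R, y)) \<and>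
    feasible R a b K h g F
    \<longrightarrow>
    (\<exists>U. is_arg_min (J_fun R d a b K h \<epsilon>) (feasible R a b K h g) U \<and>
       (\<forall>V. is_arg_min (J_fun R d a b K h \<epsilon>) (feasible R a b K h g) V \<longrightarrow>
          (\<forall>i\<le>K. \<forall>y\<in>{a..b}. V i y = U i y)) \<and>
       H1h_norm a b K h U \<le> C * H1h_norm a b K h F)"
proof -
  obtain C1 where inv: "\<And>x y. x \<in> {-R..R} \<Longrightarrow> y \<in> {a..b} \<Longrightarrow>
        invertible (lead_mat d x y :: real^'n::{finite,linorder}^'n::{finite,linorder})"
      and bound: "\<And>x y. x \<in> {-R..R} \<Longrightarrow> y \<in> {a..b} \<Longrightarrow>
        norm (D_mat d x y :: real^'n::{finite,linorder}^'n::{finite,linorder}) \<le> C1"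
      and a0: "a0 > 1"
    using assms(5-7) unfolding admissible_a0_def by blast
  \<comment> \<open>Since K = 2 R / h and h >= \<open>h0\<close>. Both k and \<open>C1\<close> are
    fixed before \<epsilon>, h, K, g and F, which gives the required order of quantifiers.\<close>
  define k where "k = 2 * R / h0"
  \<comment> \<open>\<open>CF\<close> is known to be nonnegative only if some \<open>h\<close> is admissible, hence the maximum.\<close>
  define C where "C = max 1 (sqrt (semidiscrete.CF a b h0 k C1))"
  have loc: "semidiscrete R d a b h h0 k C1 \<epsilon> K g"
    if "0 \<le> \<epsilon>" "\<epsilon> < 1" "h0 \<le> h" "h < 1" "real K = 2 * R / h"
      "C1_closed a b (\<lambda>y. g (-R, y))" "C1_closed a b (\<lambda>y. g (R, y))"
    for \<epsilon> h K and g :: "real \<times> real \<Rightarrow> real^'n::{finite,linorder}"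
  proof
    have grid: "grid_pt R h j \<in> {-R..R}" if "j \<in> {1..<K}" for j
    proof -
      have "real j * h \<le> real K * h" using that \<open>h0 \<le> h\<close> assms(3) by (intro mult_right_mono) auto
      also have "\<dots> = 2 * R" using \<open>real K = 2 * R / h\<close> \<open>h0 \<le> h\<close> assms(3) by simp
      finally show ?thesis using \<open>h0 \<le> h\<close> assms(3) by (simp add: grid_pt_def)
    qed
    show "real K \<le> k"
      unfolding k_def \<open>real K = 2 * R / h\<close> using assms(1,3) \<open>h0 \<le> h\<close> by (intro divide_left_mono) auto
    show "continuous_on {a..b} (D_mat d (grid_pt R h j) :: real \<Rightarrow> real^'n::{finite,linorder}^'n::{finite,linorder})"
      if "j \<in> {1..<K}" for j
      \<comment> \<open>\<open>a0\<close> > 1 places [a,b] in the half-line y > 0, where the kernels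
        are continuous.\<close>
      using a0 assms(6) by (intro continuous_on_D_mat inv grid that) auto
    show "norm (D_mat d (grid_pt R h j) y :: real^'n::{finite,linorder}^'n::{finite,linorder}) \<le> C1"
      if "j \<in> {1..<K}" "y \<in> {a..b}" for j y
      by (intro bound grid that)
  qed (use that assms in \<open>simp_all add: C1_closed_continuous\<close>)
  show ?thesis
  proof (intro exI[of _ C] conjI allI impI)
    show "0 < C" by (simp add: C_def)
  next
    fix \<epsilon> h :: real and K :: nat and g :: "real \<times> real \<Rightarrow> real^'n::{finite,linorder}"
      and F :: "nat \<Rightarrow> real \<Rightarrow> real^'n::{finite,linorder}"
    assume *: "0 \<le> \<epsilon> \<and> \<epsilon> < 1 \<and> h0 \<le> h \<and> h < 1 \<and> real K = 2 * R / h \<and>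
      (\<forall>x\<in>{-R..R}. g (x, a) = 0) \<and>
      C1_closed a b (\<lambda>y. g (-R, y)) \<and> C1_closed a b (\<lambda>y. g (R, y)) \<and> feasible R a b K h g F"
    then interpret semidiscrete R d a b h h0 k C1 \<epsilon> K g by (intro loc) auto
    have F: "feas F" using * by blast
    have "sqrt CF * H1h_norm a b K h F \<le> C * H1h_norm a b K h F"
      unfolding C_def H1h_norm_def using H1_nonneg[OF F] by (intro mult_right_mono) auto
    then show "\<exists>U. is_arg_min J feas U \<and> (\<forall>V. is_arg_min J feas V \<longrightarrow>
        (\<forall>i\<le>K. \<forall>y\<in>{a..b}. V i y = U i y)) \<and> H1h_norm a b K h U \<le> C * H1h_norm a b K h F"
      using minimizer_exists[OF F] order_trans by blast
  qed
qed

end
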